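(* For any finite connected graph $G$, $\overline{P(G)}\subseteq H(G)$, where $P(G)$ is the partition set of $G$, $H(G)$ is the chord set of $G$, and $\overline{P(G)}$ is the closure of $P(G)$ in $\mathbb{R}$.
   Context: Let $G=(V,E)$ be a finite connected graph with at least one edge, possibly with loops or multiple edges. Identify each edge of $G$ with the interval $[0,1]$ (glued along endpoints according to incidence) carrying the standard uniform (Lebesgue) measure. This makes $G$ a measure space $(G,\mu_G)$ with $\mu_G(G)=|E|$, and a topological space in which a subset is closed iff its intersection with each edge is closed. $L^1(G)$ denotes the set of functions $f:G\to\mathbb{R}$ whose restriction to each edge is Riemann-integrable; integrals over subsets of $G$ are with respect to $\mu_G$. $X(G)$ denotes the set of (nonempty) closed connected subsets of $G$. For $r\in[0,|E|]$, $X_r(G)=\{u\in X(G):\mu_G(u)=r\}$. The partition set $P(G)$ is the set of real numbers $r$ such that there exist a positive integer $n$ and a finite collection $\{U_\alpha\}_{\alpha=1}^k\subset X_r(G)$ such that, except for a finite number of points, every point of $G$ appears in exactly $n$ members of the collection. The chord set $H(G)$ is the set of real numbers $r$ such that for every $f\in L^1(G)$ with $\int_G f\,d\mu_G=0$ there exists $U\in X_r(G)$ with $\int_U f\,d\mu_G=0$. *)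

theory Defs
  imports "Graph_Theory.Digraph_Component" "HOL-Analysis.Analysis"
begin

text \<open>
  A multigraph, loops allowed, is a \<open>pre_digraph\<close>.  The direction of an arc only records the
  chosen identification of that edge with \<open>[0,1]\<close> (tail at 0, head at 1).  Both \<open>connected\<close>
  from \<open>Digraph_Component\<close> (of the underlying undirected graph) and the library's topological
  \<open>connected\<close> are in scope, so the former is always written qualified.
\<close>

datatype ('v, 'e) gpoint = Vertex 'v | Interior 'e real

definition graph_points :: "('v, 'e) pre_digraph \<Rightarrow> ('v, 'e) gpoint set" where
  "graph_points G =
     Vertex ` verts G \<union> {Interior e t | e t. e \<in> arcs G \<and> 0 < t \<and> t < 1}"

text \<open>The characteristic map of the edge \<open>e\<close>; only its values for \<open>0 \<le> t \<le> 1\<close> matter.\<close>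

definition edge_point :: "('v, 'e) pre_digraph \<Rightarrow> 'e \<Rightarrow> real \<Rightarrow> ('v, 'e) gpoint" where
  "edge_point G e t =
     (if t = 0 then Vertex (tail G e) else if t = 1 then Vertex (head G e) else Interior e t)"

text \<open>The intersection of \<open>A\<close> with the edge \<open>e\<close>, read in the coordinate of \<open>e\<close>.\<close>

definition edge_trace ::
    "('v, 'e) pre_digraph \<Rightarrow> 'e \<Rightarrow> ('v, 'e) gpoint set \<Rightarrow> real set" where
  "edge_trace G e A = {t \<in> {0..1}. edge_point G e t \<in> A}"

definition graph_topology :: "('v, 'e) pre_digraph \<Rightarrow> ('v, 'e) gpoint topology" where
  "graph_topology G = topology (\<lambda>U. U \<subseteq> graph_points G \<and>
     (\<forall>e\<in>arcs G. openin (top_of_set {0..1}) (edge_trace G e U)))"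

text \<open>
  Lebesgue measurability (rather than Borel) is used on the edges, since a Riemann integrable
  function need not be Borel measurable.
\<close>

definition graph_measure :: "('v, 'e) pre_digraph \<Rightarrow> ('v, 'e) gpoint measure" where
  "graph_measure G = measure_of (graph_points G)
     {A. A \<subseteq> graph_points G \<and> (\<forall>e\<in>arcs G. edge_trace G e A \<in> sets lebesgue)}
     (\<lambda>A. \<Sum>e\<in>arcs G. emeasure lebesgue (edge_trace G e A))"

text \<open>
  Riemann integrability on \<open>[a,b]\<close>: as in the definition of \<open>has_integral\<close>, but with
  constant gauges only.
\<close>

definition riemann_integrable :: "real \<Rightarrow> real \<Rightarrow> (real \<Rightarrow> real) \<Rightarrow> bool" where
  "riemann_integrable a b g \<longleftrightarrow>
     (\<exists>I. \<forall>\<epsilon>>0. \<exists>\<delta>>0. \<forall>\<D>. \<D> tagged_division_of {a..b} \<and> (\<lambda>x. ball x \<delta>) fine \<D> \<longrightarrow>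
        \<bar>(\<Sum>(x, K)\<in>\<D>. measure lborel K * g x) - I\<bar> < \<epsilon>)"

text \<open>Values of functions off \<open>graph_points G\<close> are irrelevant throughout.\<close>

definition L1_graph :: "('v, 'e) pre_digraph \<Rightarrow> (('v, 'e) gpoint \<Rightarrow> real) set" where
  "L1_graph G = {f. \<forall>e\<in>arcs G. riemann_integrable 0 1 (\<lambda>t. f (edge_point G e t))}"

definition closed_connected_sets :: "('v, 'e) pre_digraph \<Rightarrow> ('v, 'e) gpoint set set" where
  "closed_connected_sets G =
     {u. u \<noteq> {} \<and> closedin (graph_topology G) u \<and> connectedin (graph_topology G) u}"

definition closed_connected_sets_of_measure ::
    "('v, 'e) pre_digraph \<Rightarrow> real \<Rightarrow> ('v, 'e) gpoint set set" where
  "closed_connected_sets_of_measure G r =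
     {u \<in> closed_connected_sets G. measure (graph_measure G) u = r}"

definition partition_set :: "('v, 'e) pre_digraph \<Rightarrow> real set" where
  "partition_set G = {r. \<exists>n>0. \<exists>k. \<exists>U :: nat \<Rightarrow> ('v, 'e) gpoint set.
     (\<forall>\<alpha>\<in>{1..k}. U \<alpha> \<in> closed_connected_sets_of_measure G r) \<and>
     finite {x \<in> graph_points G. card {\<alpha> \<in> {1..k}. x \<in> U \<alpha>} \<noteq> n}}"

definition chord_set :: "('v, 'e) pre_digraph \<Rightarrow> real set" where
  "chord_set G = {r. \<forall>f\<in>L1_graph G. (LINT x:graph_points G|graph_measure G. f x) = 0 \<longrightarrow>
     (\<exists>U\<in>closed_connected_sets_of_measure G r. (LINT x:U|graph_measure G. f x) = 0)}"

text \<open>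
  \<open>topology\<close> and \<open>measure_of\<close> are total functions; the following facts show that they are
  applied here to an actual topology and an actual measure.
\<close>

lemma edge_trace_simps:
  "edge_trace G e {} = {}"
  "edge_trace G e (A \<inter> B) = edge_trace G e A \<inter> edge_trace G e B"
  "edge_trace G e (\<Union>\<C>) = (\<Union>A\<in>\<C>. edge_trace G e A)"
  by (auto simp: edge_trace_def)

lemma openin_graph_topology:
  "openin (graph_topology G) U \<longleftrightarrow> U \<subseteq> graph_points G \<and>
     (\<forall>e\<in>arcs G. openin (top_of_set {0..1}) (edge_trace G e U))"
proof -
  have "istopology (\<lambda>U. U \<subseteq> graph_points G \<and>
     (\<forall>e\<in>arcs G. openin (top_of_set {0..1}) (edge_trace G e U)))"
    unfolding istopology_def edge_trace_simps
    by (intro conjI allI impI ballI openin_Int openin_Union) auto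
  then show ?thesis
    by (simp add: graph_topology_def)
qed

lemma edge_point_in_graph_points:
  assumes "wf_digraph G" "e \<in> arcs G" "t \<in> {0..1}"
  shows "edge_point G e t \<in> graph_points G"
  using assms wf_digraph.tail_in_verts[of G e] wf_digraph.head_in_verts[of G e]
  by (auto simp: edge_point_def graph_points_def)

lemma edge_trace_diff:
  assumes "wf_digraph G" "e \<in> arcs G"
  shows "edge_trace G e (graph_points G - A) = {0..1} - edge_trace G e A"
  using edge_point_in_graph_points[OF assms] by (auto simp: edge_trace_def)

lemma edge_trace_graph_points:
  assumes "wf_digraph G" "e \<in> arcs G"
  shows "edge_trace G e (graph_points G) = {0..1}"
  using edge_trace_diff[OF assms, of "{}"] by (simp add: edge_trace_simps)

lemma topspace_graph_topology:
  assumes "wf_digraph G"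
  shows "topspace (graph_topology G) = graph_points G"
proof -
  have "openin (graph_topology G) (graph_points G)"
    using openin_topspace[of "top_of_set {0..1::real}"]
    by (simp add: openin_graph_topology edge_trace_graph_points[OF assms])
  then show ?thesis
    using openin_graph_topology[of G "topspace (graph_topology G)"] openin_subset by fastforce
qed

lemma closedin_graph_topology:
  assumes "wf_digraph G"
  shows "closedin (graph_topology G) C \<longleftrightarrow>
    C \<subseteq> graph_points G \<and> (\<forall>e\<in>arcs G. closed (edge_trace G e C))"
proof -
  have "closed (edge_trace G e C) \<longleftrightarrow>
      openin (top_of_set {0..1}) (edge_trace G e (graph_points G - C))" if "e \<in> arcs G" for e
  proof -
    have sub: "edge_trace G e C \<subseteq> {0..1}"
      by (auto simp: edge_trace_def)
    then have "closed (edge_trace G e C) \<longleftrightarrow> closedin (top_of_set {0..1}) (edge_trace G e C)"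
      using closedin_closed_eq[of "{0..1::real}"] by auto
    with sub show ?thesis
      by (simp add: edge_trace_diff[OF assms that] closedin_def)
  qed
  then show ?thesis
    by (auto simp: closedin_def topspace_graph_topology[OF assms] openin_graph_topology)
qed

lemma sigma_algebra_graph_measure:
  assumes "wf_digraph G"
  shows "sigma_algebra (graph_points G)
    {A. A \<subseteq> graph_points G \<and> (\<forall>e\<in>arcs G. edge_trace G e A \<in> sets lebesgue)}"
  unfolding sigma_algebra_iff2
  by (auto simp: edge_trace_simps edge_trace_diff[OF assms])

lemma space_graph_measure: "space (graph_measure G) = graph_points G"
  by (simp add: graph_measure_def space_measure_of_conv)

lemma sets_graph_measure:
  assumes "wf_digraph G"
  shows "sets (graph_measure G) =
    {A. A \<subseteq> graph_points G \<and> (\<forall>e\<in>arcs G. edge_trace G e A \<in> sets lebesgue)}"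
  unfolding graph_measure_def
  by (rule sigma_algebra.sets_measure_of_eq[OF sigma_algebra_graph_measure[OF assms]])

lemma emeasure_graph_measure:
  assumes "wf_digraph G" "finite (arcs G)" "A \<in> sets (graph_measure G)"
  shows "emeasure (graph_measure G) A = (\<Sum>e\<in>arcs G. emeasure lebesgue (edge_trace G e A))"
  unfolding graph_measure_def
proof (rule emeasure_measure_of_sigma[OF sigma_algebra_graph_measure[OF assms(1)], where ?\<mu> =
    "\<lambda>A. \<Sum>e\<in>arcs G. emeasure lebesgue (edge_trace G e A)"])
  let ?S = "{A. A \<subseteq> graph_points G \<and> (\<forall>e\<in>arcs G. edge_trace G e A \<in> sets lebesgue)}"
  let ?\<mu> = "\<lambda>A. \<Sum>e\<in>arcs G. emeasure lebesgue (edge_trace G e A)"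
  show "positive ?S ?\<mu>"
    by (simp add: positive_def edge_trace_simps)
  show "countably_additive ?S ?\<mu>"
    unfolding countably_additive_def
  proof (intro allI impI)
    fix F :: "nat \<Rightarrow> _" assume F: "range F \<subseteq> ?S" "disjoint_family F"
    have "(\<Sum>i. emeasure lebesgue (edge_trace G e (F i))) =
        emeasure lebesgue (edge_trace G e (\<Union>(range F)))" if "e \<in> arcs G" for e
    proof -
      have "edge_trace G e (\<Union>(range F)) = (\<Union>i. edge_trace G e (F i))"
        by (simp add: edge_trace_simps)
      moreover have "disjoint_family (\<lambda>i. edge_trace G e (F i))"
        using F(2) by (fastforce simp: disjoint_family_on_def edge_trace_def)
      moreover have "range (\<lambda>i. edge_trace G e (F i)) \<subseteq> sets lebesgue"
        using F(1) that by blast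
      ultimately show ?thesis
        using suminf_emeasure by metis
    qed
    then show "(\<Sum>i. ?\<mu> (F i)) = ?\<mu> (\<Union>(range F))"
      by (simp add: suminf_sum)
  qed
  show "A \<in> ?S"
    using assms(3) by (simp add: sets_graph_measure[OF assms(1)])
qed

lemma measure_graph_points:
  assumes "wf_digraph G" "finite (arcs G)"
  shows "measure (graph_measure G) (graph_points G) = card (arcs G)"
proof -
  have "graph_points G \<in> sets (graph_measure G)"
    using sets.top[of "graph_measure G"] by (simp add: space_graph_measure)
  then have "emeasure (graph_measure G) (graph_points G) = of_nat (card (arcs G))"
    by (simp add: emeasure_graph_measure[OF assms] edge_trace_graph_points[OF assms(1)])
  then show ?thesis
    by (simp add: measure_def)
qed

end

theory Submission
  imports Defs
begin

text \<open>
  Fix \<open>f\<close> with integral 0 over the graph, and call \<open>I U\<close> its integral over \<open>U\<close>.  The core is an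
  intermediate value argument for two closed connected sets \<open>U\<close>, \<open>V\<close> of the same measure \<open>r\<close>
  with a common point \<open>p\<close> (\<open>zero_between\<close>).  Sweep out \<open>U\<close> and \<open>V\<close> by increasing families \<open>S s\<close> and
  \<open>T t\<close> of closed connected sets that contain \<open>p\<close> and have measures \<open>s\<close> and \<open>t\<close>.  All the sets
  \<open>S s \<union> T t\<close> are connected, because both parts contain \<open>p\<close>.  While \<open>t\<close> runs from \<open>0\<close> to \<open>r\<close>, choose
  \<open>s\<close> so that \<open>S s \<union> T t\<close> keeps the measure \<open>r\<close>: this leads from \<open>U\<close> to \<open>V\<close>, up to null sets, and
  since \<open>f\<close> is bounded the integral is a continuous function of \<open>t\<close>.  So if \<open>I U\<close> and \<open>I V\<close> have
  opposite signs, some closed connected set of measure \<open>r\<close> has integral 0.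

  Suppose that no closed connected set of measure \<open>r > 0\<close> has integral 0.  Then two such sets
  with a common point have integrals of the same sign.  Any two points of an edge at distance
  at most \<open>r\<close> lie in a common closed connected set of measure \<open>r\<close>, hence the sign propagates along
  edges and is the same for all closed connected sets of measure \<open>r\<close> (\<open>same_sign\<close>).  But the
  members of a partition of multiplicity \<open>n\<close> have integrals that add up to \<open>n\<close> times the integral
  over the graph, that is, to 0; so \<open>r\<close> is not in the partition set (\<open>zero_of_partition\<close>).

  The passage to the closure is compactness (\<open>closed_connected_sequence_compact\<close>).  A closed
  connected set meets every edge in at most two segments
  (\<open>closed_connected_eq_Union_segments\<close>), so it is described by boundedly many parameters in
  \<open>[0,1]\<close>, and a sequence of such sets has a subsequence whose segments converge.  Two segments
  that meet along the sequence still meet in the limit; therefore the limit is connected.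
  Measure and integral are continuous under this convergence.

  The combinatorial device behind both the sweeping families and the limits is the following.
  A finite union of nonempty segments is connected iff the family is \<open>linked\<close>, i.e. its
  intersection graph is connected; and then it can be built from any of its points by attaching one segment at a
  time (\<open>grown\<close>), which provides an induction principle for closed connected sets.
\<close>

section \<open>Riemann integrable functions\<close>

lemma riemann_integrable_imp_integrable_on:
  assumes "riemann_integrable a b g"
  shows "g integrable_on {a..b}"
proof -
  obtain I where I: "\<And>\<epsilon>. \<epsilon> > 0 \<Longrightarrow> \<exists>\<delta>>0. \<forall>\<D>. \<D> tagged_division_of {a..b} \<and> (\<lambda>x. ball x \<delta>) fine \<D> \<longrightarrow>
      \<bar>(\<Sum>(x, K)\<in>\<D>. measure lborel K * g x) - I\<bar> < \<epsilon>"
    using assms unfolding riemann_integrable_def by blast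
  have "(g has_integral I) {a..b}"
    unfolding has_integral_real
  proof (intro allI impI)
    fix \<epsilon> :: real assume "\<epsilon> > 0"
    with I obtain \<delta> where "\<delta> > 0" and *: "\<forall>\<D>. \<D> tagged_division_of {a..b} \<and> (\<lambda>x. ball x \<delta>) fine \<D> \<longrightarrow>
      \<bar>(\<Sum>(x, K)\<in>\<D>. measure lborel K * g x) - I\<bar> < \<epsilon>"
      by blast
    show "\<exists>\<gamma>. gauge \<gamma> \<and> (\<forall>\<D>. \<D> tagged_division_of {a..b} \<and> \<gamma> fine \<D> \<longrightarrow>
      norm ((\<Sum>(x, K)\<in>\<D>. measure lborel K *\<^sub>R g x) - I) < \<epsilon>)"
      using * gauge_ball[OF \<open>\<delta> > 0\<close>] by (intro exI[of _ "\<lambda>x. ball x \<delta>"]) auto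
  qed
  then show ?thesis by blast
qed

lemma tagged_division_of_equidistant:
  fixes a h :: real
  assumes "h > 0" "N > 0" "\<And>i. i < N \<Longrightarrow> \<tau> i \<in> {a + real i * h..a + real (Suc i) * h}"
  shows "(\<lambda>i. (\<tau> i, {a + real i * h..a + real (Suc i) * h})) ` {..<N}
    tagged_division_of {a..a + real N * h}"
proof (rule tagged_division_ofI)
  let ?K = "\<lambda>i. {a + real i * h..a + real (Suc i) * h}"
  have mono: "a + real i * h \<le> a + real j * h" if "i \<le> j" for i j
    using that \<open>h > 0\<close> by simp
  show "finite ((\<lambda>i. (\<tau> i, ?K i)) ` {..<N})"
    by simp
  fix x K assume xK: "(x, K) \<in> (\<lambda>i. (\<tau> i, ?K i)) ` {..<N}"
  then obtain i where i: "i < N" "x = \<tau> i" "K = ?K i"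
    by auto
  show "x \<in> K" using assms(3) i by auto
  show "K \<subseteq> {a..a + real N * h}"
    unfolding i using mono[of 0 i] mono[of "Suc i" N] i(1) by (auto simp del: of_nat_Suc)
  show "\<exists>u v. K = cbox u v"
    using i(3) by (metis cbox_interval)
  fix y L assume "(y, L) \<in> (\<lambda>i. (\<tau> i, ?K i)) ` {..<N}" and ne: "(x, K) \<noteq> (y, L)"
  then obtain j where j: "j < N" "y = \<tau> j" "L = ?K j"
    by auto
  with i ne have "Suc i \<le> j \<or> Suc j \<le> i" by (metis not_less_eq_eq order_antisym)
  then show "interior K \<inter> interior L = {}"
    using mono[of "Suc i" j] mono[of "Suc j" i] i j by (auto simp del: of_nat_Suc)
next
  let ?K = "\<lambda>i. {a + real i * h..a + real (Suc i) * h}"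
  have "(\<Union>i<Suc n. ?K i) = {a..a + real (Suc n) * h}" for n
  proof (induction n)
    case (Suc n)
    have "a \<le> a + real (Suc n) * h" "a + real (Suc n) * h \<le> a + real (Suc (Suc n)) * h"
      using \<open>h > 0\<close> by (auto simp: algebra_simps)
    then show ?case
      unfolding lessThan_Suc[of "Suc n"] using Suc by (auto simp del: of_nat_Suc)
  qed auto
  from this[of "N - 1"] \<open>N > 0\<close> have "(\<Union>i<N. ?K i) = {a..a + real N * h}"
    by simp
  moreover have "{K. \<exists>x. (x, K) \<in> (\<lambda>i. (\<tau> i, ?K i)) ` {..<N}} = ?K ` {..<N}"
    by blast
  ultimately show "\<Union>{K. \<exists>x. (x, K) \<in> (\<lambda>i. (\<tau> i, ?K i)) ` {..<N}} = {a..a + real N * h}"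
    by (simp del: of_nat_Suc)
qed

text \<open>
  A constant gauge admits a fixed equidistant division with every choice of tags.  Moving a
  single tag to \<open>t\<close> changes only the summand \<open>h * g t\<close>, while all Riemann sums stay within 1 of the
  integral; this bounds \<open>g t\<close> independently of \<open>t\<close>.  With variable gauges the argument breaks
  down: unbounded functions can be Henstock-Kurzweil integrable.
\<close>

lemma riemann_integrable_imp_bounded:
  assumes "riemann_integrable a b g" "a < b"
  shows "\<exists>B. \<forall>t\<in>{a..b}. \<bar>g t\<bar> \<le> B"
proof -
  obtain I \<delta> where "\<delta> > 0"
    and I: "\<And>\<D>. \<D> tagged_division_of {a..b} \<Longrightarrow> (\<lambda>x. ball x \<delta>) fine \<D> \<Longrightarrow>
      \<bar>(\<Sum>(x, K)\<in>\<D>. measure lborel K * g x) - I\<bar> < 1"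
    using assms(1) zero_less_one unfolding riemann_integrable_def by blast
  obtain N :: nat where N: "(b - a) / \<delta> < N"
    using reals_Archimedean2 by blast
  moreover have "(b - a) / \<delta> > 0"
    using assms(2) \<open>\<delta> > 0\<close> by simp
  ultimately have "N > 0"
    by (cases N) auto
  define h where "h = (b - a) / N"
  have h: "h > 0" "h < \<delta>" "a + real N * h = b"
    using N \<open>N > 0\<close> assms(2) \<open>\<delta> > 0\<close> by (auto simp: h_def divide_simps mult.commute)
  let ?K = "\<lambda>i. {a + real i * h..a + real (Suc i) * h}"
  have sum: "\<bar>(\<Sum>i<N. h * g (\<tau> i)) - I\<bar> < 1" if \<tau>: "\<And>i. i < N \<Longrightarrow> \<tau> i \<in> ?K i" for \<tau>
  proof -
    have inj: "inj_on (\<lambda>i. (\<tau> i, ?K i)) {..<N}"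
    proof (rule inj_onI)
      fix i j assume "(\<tau> i, ?K i) = (\<tau> j, ?K j)"
      then have "?K i = ?K j" by simp
      moreover have "a + real i * h \<le> a + real (Suc i) * h" using h by simp
      ultimately have "a + real i * h = a + real j * h"
        by (meson Icc_eq_Icc)
      then show "i = j" using h by simp
    qed
    have "(\<lambda>x. ball x \<delta>) fine ((\<lambda>i. (\<tau> i, ?K i)) ` {..<N})"
    proof (rule fineI)
      fix x K assume "(x, K) \<in> (\<lambda>i. (\<tau> i, ?K i)) ` {..<N}"
      then obtain i where i: "i < N" "x = \<tau> i" "K = ?K i" by auto
      with \<tau>[of i] h show "K \<subseteq> ball x \<delta>"
        by (auto simp: dist_real_def algebra_simps)
    qed
    from I[OF tagged_division_of_equidistant[OF h(1) \<open>N > 0\<close> \<tau>, unfolded h] this]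
    have "\<bar>(\<Sum>i<N. measure lborel (?K i) * g (\<tau> i)) - I\<bar> < 1"
      unfolding sum.reindex[OF inj] o_def split .
    moreover have "measure lborel (?K i) = h" for i
      using h by (simp add: algebra_simps)
    ultimately show ?thesis by simp
  qed
  define l where "l = (\<lambda>i::nat. a + real i * h)"
  show ?thesis
  proof (intro exI ballI)
    fix t assume t: "t \<in> {a..b}"
    have "(\<lambda>i. (l i, ?K i)) ` {..<N} tagged_division_of {a..b}"
      using tagged_division_of_equidistant[OF h(1) \<open>N > 0\<close>, of l a, unfolded h] h(1) by (simp add: l_def)
    from t[folded division_ofD(6)[OF division_of_tagged_division[OF this]]]
    obtain K where "K \<in> snd ` (\<lambda>i. (l i, ?K i)) ` {..<N}" "t \<in> K"
      by (rule UnionE)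
    then obtain j where j: "j < N" "t \<in> ?K j"
      by (elim imageE) (simp only: snd_conv lessThan_iff that)
    \<comment> \<open>The tags are the left endpoints, except that the interval of \<open>t\<close> is tagged with \<open>t\<close>.\<close>
    define S where "S = (\<Sum>i\<in>{..<N} - {j}. h * g (l i))"
    have "\<bar>(\<Sum>i<N. h * g ((l(j := t)) i)) - I\<bar> < 1"
      using j h by (intro sum) (auto simp: l_def)
    also have "(\<Sum>i<N. h * g ((l(j := t)) i)) = h * g t + S"
      using j by (subst sum.remove[of _ j]) (auto simp: S_def)
    finally have "\<bar>h * g t\<bar> < 1 + \<bar>I\<bar> + \<bar>S\<bar>"
      by linarith
    then have "h * \<bar>g t\<bar> < 1 + \<bar>I\<bar> + \<bar>S\<bar>"
      using h(1) by (simp add: abs_mult)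
    also have "\<bar>S\<bar> \<le> (\<Sum>i<N. \<bar>h * g (l i)\<bar>)"
      unfolding S_def by (rule order_trans[OF sum_abs]) (auto intro: sum_mono2)
    finally show "\<bar>g t\<bar> \<le> (1 + \<bar>I\<bar> + (\<Sum>i<N. \<bar>h * g (l i)\<bar>)) / h"
      using h(1) by (simp add: pos_le_divide_eq mult.commute)
  qed
qed

section \<open>Segments of edges\<close>

definition edge_segment :: "('v, 'e) pre_digraph \<Rightarrow> 'e \<Rightarrow> real \<Rightarrow> real \<Rightarrow> ('v, 'e) gpoint set" where
  "edge_segment G e a b = edge_point G e ` {a..b}"

lemma edge_point_eqD:
  "edge_point G e s = edge_point G e' t \<Longrightarrow> (e = e' \<and> s = t) \<or> (s \<in> {0, 1} \<and> t \<in> {0, 1})"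
  by (auto simp: edge_point_def split: if_splits)

text \<open>
  An edge can meet a segment of another edge at its ends only; a loop or a neighbouring edge
  does so through shared vertices.  The set \<open>F\<close> collects these accidental points, which affect
  neither closedness nor measure.
\<close>

lemma edge_trace_edge_segment:
  assumes "0 \<le> a" "b \<le> 1"
  obtains F where "F \<subseteq> {0, 1}"
    "edge_trace G e' (edge_segment G e a b) = (if e' = e then {a..b} else {}) \<union> F"
proof (rule that)
  show "edge_trace G e' (edge_segment G e a b) \<inter> {0, 1} \<subseteq> {0, 1}"
    by blast
  show "edge_trace G e' (edge_segment G e a b) =
      (if e' = e then {a..b} else {}) \<union> edge_trace G e' (edge_segment G e a b) \<inter> {0, 1}"
    (is "?T = ?I \<union> _")
  proof -
    have "t \<in> ?I \<union> {0, 1}" if "t \<in> ?T" for t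
    proof -
      from that obtain s where "edge_point G e' t = edge_point G e s" "s \<in> {a..b}"
        by (auto simp: edge_trace_def edge_segment_def)
      then show ?thesis
        using edge_point_eqD[of G e' t e s] by auto
    qed
    moreover have "?I \<subseteq> ?T"
      using assms by (auto simp: edge_trace_def edge_segment_def)
    ultimately show ?thesis
      by blast
  qed
qed

context wf_digraph
begin

lemma edge_segment_subset:
  assumes "e \<in> arcs G" "0 \<le> a" "b \<le> 1"
  shows "edge_segment G e a b \<subseteq> graph_points G"
  using assms edge_point_in_graph_points[OF wf_digraph_axioms assms(1)]
  by (auto simp: edge_segment_def)

lemma closedin_edge_segment:
  assumes "e \<in> arcs G" "0 \<le> a" "b \<le> 1"
  shows "closedin (graph_topology G) (edge_segment G e a b)"
proof -
  have "closed (edge_trace G e' (edge_segment G e a b))" for e'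
  proof -
    obtain F where "F \<subseteq> {0, 1}"
      and F: "edge_trace G e' (edge_segment G e a b) = (if e' = e then {a..b} else {}) \<union> F"
      by (rule edge_trace_edge_segment[OF assms(2,3)])
    then have "closed F"
      by (meson finite.emptyI finite.insertI finite_imp_closed finite_subset)
    then show ?thesis
      unfolding F by auto
  qed
  then show ?thesis
    unfolding closedin_graph_topology[OF wf_digraph_axioms]
    using edge_segment_subset[OF assms] by blast
qed

lemma continuous_map_edge_point:
  assumes "e \<in> arcs G"
  shows "continuous_map (top_of_set {0..1}) (graph_topology G) (edge_point G e)"
  unfolding continuous_map_def
proof (intro conjI allI impI funcsetI)
  fix t assume "t \<in> topspace (top_of_set {0..1::real})"
  then show "edge_point G e t \<in> topspace (graph_topology G)"
    using edge_point_in_graph_points[OF wf_digraph_axioms assms]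
    by (simp add: topspace_graph_topology[OF wf_digraph_axioms])
next
  fix U assume "openin (graph_topology G) U"
  then have "openin (top_of_set {0..1}) (edge_trace G e U)"
    using assms by (simp add: openin_graph_topology)
  then show "openin (top_of_set {0..1}) {t \<in> topspace (top_of_set {0..1}). edge_point G e t \<in> U}"
    by (simp add: edge_trace_def)
qed

lemma connectedin_edge_segment:
  assumes "e \<in> arcs G" "0 \<le> a" "b \<le> 1"
  shows "connectedin (graph_topology G) (edge_segment G e a b)"
  unfolding edge_segment_def using assms
  by (intro connectedin_continuous_map_image[OF continuous_map_edge_point])
     (auto simp: connectedin_subtopology)

lemma closedin_imp_sets_graph_measure:
  assumes "closedin (graph_topology G) U"
  shows "U \<in> sets (graph_measure G)"
  using assms unfolding closedin_graph_topology[OF wf_digraph_axioms] sets_graph_measure[OF wf_digraph_axioms]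
  by (auto intro: borel_closed)

end

context fin_digraph
begin

lemma finite_measure_graph_measure: "finite_measure (graph_measure G)"
proof
  have "graph_points G \<in> sets (graph_measure G)"
    using sets.top[of "graph_measure G"] by (simp add: space_graph_measure)
  then show "emeasure (graph_measure G) (space (graph_measure G)) \<noteq> \<infinity>"
    by (simp add: emeasure_graph_measure[OF wf_digraph_axioms] space_graph_measure
        edge_trace_graph_points[OF wf_digraph_axioms])
qed

lemma measure_edge_segment:
  assumes "e \<in> arcs G" "0 \<le> a" "a \<le> b" "b \<le> 1"
  shows "measure (graph_measure G) (edge_segment G e a b) = b - a"
proof -
  have *: "emeasure lebesgue (edge_trace G e' (edge_segment G e a b)) = (if e' = e then ennreal (b - a) else 0)" for e'
  proof -
    obtain F where "F \<subseteq> {0, 1}"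
      and F: "edge_trace G e' (edge_segment G e a b) = (if e' = e then {a..b} else {}) \<union> F"
      by (rule edge_trace_edge_segment[OF assms(2,4)])
    then have "finite F"
      by (meson finite.emptyI finite.insertI finite_subset)
    then have "F \<in> null_sets lebesgue"
      by (meson negligible_finite negligible_iff_null_sets)
    then show ?thesis
      unfolding F using assms(3) emeasure_Un_null_set[of "{a..b}" lebesgue F]
      by (cases "e' = e") (simp_all add: null_setsD1)
  qed
  have "emeasure (graph_measure G) (edge_segment G e a b) = ennreal (b - a)"
    using closedin_imp_sets_graph_measure[OF closedin_edge_segment[OF assms(1,2,4)]] assms(1)
    by (simp add: emeasure_graph_measure[OF wf_digraph_axioms] *)
  then show ?thesis
    using assms(3) by (simp add: measure_def)
qed

end

section \<open>Linked families and grown sets\<close>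

text \<open>
  Connectedness of the intersection graph of the family, expressed without paths: every
  splitting of the index set into two nonempty parts is bridged by two sets that meet.
\<close>

definition linked :: "'i set \<Rightarrow> ('i \<Rightarrow> 'a set) \<Rightarrow> bool" where
  "linked J S \<longleftrightarrow> (\<forall>R. R \<subseteq> J \<and> R \<noteq> {} \<and> R \<noteq> J \<longrightarrow> (\<exists>i\<in>R. \<exists>j\<in>J - R. S i \<inter> S j \<noteq> {}))"

lemma connectedin_Union_imp_linked:
  assumes "connectedin X (\<Union>i\<in>J. S i)" "finite J"
    and "\<And>i. i \<in> J \<Longrightarrow> closedin X (S i)" "\<And>i. i \<in> J \<Longrightarrow> S i \<noteq> {}"
  shows "linked J S"
  unfolding linked_def
proof (intro allI impI, elim conjE, rule ccontr)
  fix R assume R: "R \<subseteq> J" "R \<noteq> {}" "R \<noteq> J"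
    and disj: "\<not> (\<exists>i\<in>R. \<exists>j\<in>J - R. S i \<inter> S j \<noteq> {})"
  let ?A = "\<Union>i\<in>R. S i" and ?B = "\<Union>i\<in>J - R. S i"
  have "finite R"
    using R(1) assms(2) by (rule finite_subset)
  then have "closedin X ?A"
    using R(1) assms(3) by (intro closedin_Union) auto
  moreover have "closedin X ?B"
    using assms(2,3) by (intro closedin_Union) auto
  moreover have "(\<Union>i\<in>J. S i) \<subseteq> ?A \<union> ?B"
    by blast
  moreover have "?A \<inter> ?B \<inter> (\<Union>i\<in>J. S i) = {}"
    using disj by blast
  moreover have "?A \<inter> (\<Union>i\<in>J. S i) \<noteq> {}"
    using R(1,2) assms(4) by fast
  moreover have "?B \<inter> (\<Union>i\<in>J. S i) \<noteq> {}"
    using R(1,3) assms(4) by fast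
  ultimately have "\<exists>E1 E2. closedin X E1 \<and> closedin X E2 \<and> (\<Union>i\<in>J. S i) \<subseteq> E1 \<union> E2 \<and>
      E1 \<inter> E2 \<inter> (\<Union>i\<in>J. S i) = {} \<and> E1 \<inter> (\<Union>i\<in>J. S i) \<noteq> {} \<and> E2 \<inter> (\<Union>i\<in>J. S i) \<noteq> {}"
    by (intro exI[of _ ?A] exI[of _ ?B] conjI)
  with connectedin_closedin[THEN iffD1, OF assms(1), THEN conjunct2] show False
    by (rule notE)
qed

text \<open>
  The sets that arise from the point \<open>p\<close> by attaching finitely many segments.  The new segment may
  be attached at any of its points \<open>c\<close>, not only at an end, since it may have to extend in
  both directions.
\<close>

inductive grown :: "('v, 'e) pre_digraph \<Rightarrow> ('v, 'e) gpoint \<Rightarrow> ('v, 'e) gpoint set \<Rightarrow> bool"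
  for G p where
  point: "p \<in> graph_points G \<Longrightarrow> grown G p {p}"
| attach: "grown G p K \<Longrightarrow> e \<in> arcs G \<Longrightarrow> 0 \<le> a \<Longrightarrow> b \<le> 1 \<Longrightarrow> c \<in> {a..b} \<Longrightarrow>
    edge_point G e c \<in> K \<Longrightarrow> grown G p (K \<union> edge_segment G e a b)"

lemma grown_root_mem: "grown G p K \<Longrightarrow> p \<in> K"
  by (induction rule: grown.induct) auto

text \<open>
  Replay the construction of \<open>L\<close> on top of \<open>K\<close>, which contains the root already.
\<close>

lemma grown_Un:
  assumes "grown G p K" "grown G p L"
  shows "grown G p (K \<union> L)"
  using assms(2)
proof (induction rule: grown.induct)
  case point
  then show ?case
    using assms(1) grown_root_mem[OF assms(1)] by (simp add: insert_absorb)
next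
  case (attach L e a b c)
  then have "grown G p ((K \<union> L) \<union> edge_segment G e a b)"
    by (intro grown.attach[where c = c]) auto
  then show ?case
    by (simp add: Un_assoc)
qed

text \<open>
  Consider the indices \<open>R\<close> whose segment lies in a grown subset of the union.  A segment that
  meets one of these can itself be attached, so \<open>R\<close> cannot be separated from the remaining
  indices, and linkedness forces \<open>R = J\<close>.  Finitely many grown sets with the same root have a grown
  union.
\<close>

lemma linked_imp_grown:
  assumes "finite J" "linked J (\<lambda>j. edge_segment G (e j) (a j) (b j))"
    and seg: "\<And>j. j \<in> J \<Longrightarrow> e j \<in> arcs G \<and> 0 \<le> a j \<and> b j \<le> 1"
    and p: "p \<in> (\<Union>j\<in>J. edge_segment G (e j) (a j) (b j))" "p \<in> graph_points G"
  shows "grown G p (\<Union>j\<in>J. edge_segment G (e j) (a j) (b j))"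
proof -
  let ?S = "\<lambda>j. edge_segment G (e j) (a j) (b j)"
  define U where "U = (\<Union>j\<in>J. ?S j)"
  define R where "R = {j \<in> J. \<exists>K. grown G p K \<and> ?S j \<subseteq> K \<and> K \<subseteq> U}"
  have add: "j \<in> R" if "j \<in> J" "grown G p K" "K \<subseteq> U" "?S j \<inter> K \<noteq> {}" for j K
  proof -
    from that(4) obtain c where "c \<in> {a j..b j}" "edge_point G (e j) c \<in> K"
      unfolding edge_segment_def by blast
    with seg[OF that(1)] that(2) have "grown G p (K \<union> ?S j)"
      by (intro grown.attach) auto
    moreover have "K \<union> ?S j \<subseteq> U"
      using that(1,3) by (auto simp: U_def)
    ultimately show ?thesis
      unfolding R_def using that(1) by blast
  qed
  have "R \<noteq> {}"
  proof -
    from p(1) obtain j where "j \<in> J" "p \<in> ?S j" by blast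
    moreover have "{p} \<subseteq> U"
      using p(1) by (simp add: U_def)
    ultimately have "j \<in> R"
      by (intro add[OF _ grown.point[OF p(2)]]) simp_all
    then show ?thesis by blast
  qed
  moreover have "R \<subseteq> J"
    by (auto simp: R_def)
  moreover have "\<not> (\<exists>i\<in>R. \<exists>j\<in>J - R. ?S i \<inter> ?S j \<noteq> {})"
  proof
    assume "\<exists>i\<in>R. \<exists>j\<in>J - R. ?S i \<inter> ?S j \<noteq> {}"
    then obtain i j where ij: "i \<in> R" "j \<in> J" "j \<notin> R" "?S i \<inter> ?S j \<noteq> {}"
      by blast
    from ij(1) obtain K where K: "grown G p K" "?S i \<subseteq> K" "K \<subseteq> U"
      unfolding R_def by blast
    then have "j \<in> R"
      using ij(4) by (intro add[OF ij(2) K(1,3)]) blast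
    with ij(3) show False ..
  qed
  ultimately have "R = J"
    using assms(2) unfolding linked_def by blast
  have "\<exists>K. grown G p K \<and> (\<Union>j\<in>F. ?S j) \<subseteq> K \<and> K \<subseteq> U" if "finite F" "F \<subseteq> J" for F
    using that
  proof (induction F)
    case empty
    then show ?case
      using grown.point[OF p(2)] p(1) by (intro exI[of _ "{p}"]) (auto simp: U_def)
  next
    case (insert j F)
    then obtain K where "grown G p K" "(\<Union>j\<in>F. ?S j) \<subseteq> K" "K \<subseteq> U"
      by auto
    moreover from insert(4) have "j \<in> R"
      unfolding \<open>R = J\<close> by simp
    then obtain L where "grown G p L" "?S j \<subseteq> L" "L \<subseteq> U"
      unfolding R_def by blast
    ultimately show ?case
      by (intro exI[of _ "K \<union> L"] conjI grown_Un) auto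
  qed
  from this[OF assms(1) order_refl] obtain K where "grown G p K" "U \<subseteq> K" "K \<subseteq> U"
    unfolding U_def by blast
  then have "grown G p U"
    by (metis order_antisym)
  then show ?thesis
    unfolding U_def .
qed

lemma (in wf_digraph) grown_closed_connected:
  assumes "grown G p K"
  shows "K \<in> closed_connected_sets G"
  using assms
proof (induction rule: grown.induct)
  case point
  have "closed (edge_trace G e {p})" for e
  proof -
    have "finite (edge_trace G e {p})"
    proof (rule finite_subset)
      show "edge_trace G e {p} \<subseteq> {0, 1} \<union> {THE t. p = Interior e t}"
        by (auto simp: edge_trace_def edge_point_def split: if_splits)
      show "finite ({0, 1} \<union> {THE t. p = Interior e t})"
        by simp
    qed
    then show ?thesis by (rule finite_imp_closed)
  qed
  with point show ?case
    by (simp add: closed_connected_sets_def closedin_graph_topology[OF wf_digraph_axioms]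
        topspace_graph_topology[OF wf_digraph_axioms])
next
  case (attach K e a b c)
  have "edge_point G e c \<in> K \<inter> edge_segment G e a b"
    using attach by (auto simp: edge_segment_def)
  then have "connectedin (graph_topology G) (K \<union> edge_segment G e a b)"
    using attach by (intro connectedin_Un connectedin_edge_segment) (auto simp: closed_connected_sets_def)
  moreover have "closedin (graph_topology G) (K \<union> edge_segment G e a b)"
    using attach by (intro closedin_Un closedin_edge_segment) (auto simp: closed_connected_sets_def)
  ultimately show ?case
    using attach.IH by (simp add: closed_connected_sets_def)
qed

section \<open>The graph is a linked family of edges\<close>

locale metric_graph = fin_digraph G for G :: "('v, 'e) pre_digraph" +
  assumes conn: "Digraph_Component.connected G" and arcs_nonempty: "arcs G \<noteq> {}"
begin

lemma verts_subset_if_closed_under_arcs: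
  assumes "S \<noteq> {}" "S \<subseteq> verts G" "\<And>e. e \<in> arcs G \<Longrightarrow> tail G e \<in> S \<longleftrightarrow> head G e \<in> S"
  shows "verts G \<subseteq> S"
proof
  fix v assume "v \<in> verts G"
  from assms(1,2) obtain u where "u \<in> S" "u \<in> verts G" by blast
  with \<open>v \<in> verts G\<close> have "u \<rightarrow>\<^sup>*\<^bsub>mk_symmetric G\<^esub> v"
    using conn unfolding Digraph_Component.connected_def strongly_connected_def by simp
  then have "(u, v) \<in> (arcs_ends (mk_symmetric G))\<^sup>*"
    by (rule reachable_rtranclI)
  then show "v \<in> S"
  proof (induction rule: rtrancl_induct)
    case base
    show ?case by (rule \<open>u \<in> S\<close>)
  next
    case (step x y)
    then have "(x, y) \<in> parcs (mk_symmetric G)"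
      by simp
    with step.IH assms(3) show ?case
      by (auto simp: parcs_mk_symmetric)
  qed
qed

text \<open>
  Connectedness together with the presence of an edge excludes isolated vertices; as a
  consequence the edges cover the whole graph.
\<close>

lemma vertex_in_full_segment:
  assumes "v \<in> verts G"
  shows "\<exists>e\<in>arcs G. Vertex v \<in> edge_segment G e 0 1"
proof -
  have *: "Vertex (tail G e) \<in> edge_segment G e 0 1" "Vertex (head G e) \<in> edge_segment G e 0 1" for e
    by (auto simp: edge_segment_def image_iff edge_point_def)
  have "verts G \<subseteq> tail G ` arcs G \<union> head G ` arcs G"
    by (rule verts_subset_if_closed_under_arcs) (use arcs_nonempty in auto)
  with assms * show ?thesis by blast
qed

lemma graph_points_eq_Union_segments: "graph_points G = (\<Union>e\<in>arcs G. edge_segment G e 0 1)"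
proof
  show "(\<Union>e\<in>arcs G. edge_segment G e 0 1) \<subseteq> graph_points G"
    using edge_segment_subset by (intro UN_least) simp
  show "graph_points G \<subseteq> (\<Union>e\<in>arcs G. edge_segment G e 0 1)"
  proof
    fix x assume "x \<in> graph_points G"
    then consider v where "v \<in> verts G" "x = Vertex v"
      | e t where "e \<in> arcs G" "0 < t" "t < 1" "x = Interior e t"
      unfolding graph_points_def by blast
    then show "x \<in> (\<Union>e\<in>arcs G. edge_segment G e 0 1)"
    proof cases
      case 1
      then show ?thesis using vertex_in_full_segment by simp
    next
      case 2
      then have "x = edge_point G e t" by (simp add: edge_point_def)
      moreover have "t \<in> {0..1}" using 2 by simp
      ultimately have "x \<in> edge_segment G e 0 1"
        unfolding edge_segment_def by (rule image_eqI)
      with 2(1) show ?thesis by (rule UN_I)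
    qed
  qed
qed

lemma graph_point_cases:
  assumes "x \<in> graph_points G"
  obtains e t where "e \<in> arcs G" "t \<in> {0..1}" "x = edge_point G e t"
  using assms unfolding graph_points_eq_Union_segments edge_segment_def by blast

text \<open>
  If the edges in \<open>R\<close> met no others, their ends would form a set of vertices that no edge leaves.
  By connectedness these would be all vertices, and every edge meets its own ends.
\<close>

lemma linked_full_segments: "linked (arcs G) (\<lambda>e. edge_segment G e 0 1)"
  unfolding linked_def
proof (intro allI impI, elim conjE, rule ccontr)
  fix R assume R: "R \<subseteq> arcs G" "R \<noteq> {}" "R \<noteq> arcs G"
    and disj: "\<not> (\<exists>e\<in>R. \<exists>e'\<in>arcs G - R. edge_segment G e 0 1 \<inter> edge_segment G e' 0 1 \<noteq> {})"
  have *: "Vertex (tail G e) \<in> edge_segment G e 0 1" "Vertex (head G e) \<in> edge_segment G e 0 1" for e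
    by (auto simp: edge_segment_def image_iff edge_point_def)
  define S where "S = tail G ` R \<union> head G ` R"
  have in_R: "e \<in> R" if "e \<in> arcs G" "tail G e \<in> S \<or> head G e \<in> S" for e
  proof -
    from that(2) obtain e' where e': "e' \<in> R"
      "tail G e = tail G e' \<or> tail G e = head G e' \<or> head G e = tail G e' \<or> head G e = head G e'"
      by (auto simp: S_def)
    then have "edge_segment G e' 0 1 \<inter> edge_segment G e 0 1 \<noteq> {}"
      using *[of e] *[of e'] by (elim disjE) (simp_all only: disjoint_iff, (metis | blast)+)
    with disj e'(1) that(1) show ?thesis by blast
  qed
  have "verts G \<subseteq> S"
  proof (rule verts_subset_if_closed_under_arcs)
    show "S \<noteq> {}" using R(2) by (simp add: S_def)
    show "S \<subseteq> verts G" using R(1) by (auto simp: S_def)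
    fix e assume "e \<in> arcs G"
    moreover have "e \<in> R \<Longrightarrow> tail G e \<in> S" "e \<in> R \<Longrightarrow> head G e \<in> S"
      by (simp_all add: S_def)
    ultimately show "tail G e \<in> S \<longleftrightarrow> head G e \<in> S"
      using in_R[of e] by blast
  qed
  moreover from R(1,3) obtain e where "e \<in> arcs G" "e \<notin> R" by blast
  ultimately show False
    using in_R[of e] tail_in_verts[of e] by blast
qed

lemma grown_graph_points:
  assumes "p \<in> graph_points G"
  shows "grown G p (graph_points G)"
  using assms linked_imp_grown[OF finite_arcs linked_full_segments, of p]
  unfolding graph_points_eq_Union_segments by simp

text \<open>
  Two points of an edge outside \<open>U\<close> cut an interval out of the edge.  Its part in \<open>U\<close> is open in
  \<open>U\<close>, and also closed because the two boundary points are missing; so if it is nonempty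
  it is all of \<open>U\<close>.
\<close>

lemma closed_connected_subset_open_edge:
  assumes "U \<in> closed_connected_sets G" "e \<in> arcs G" "t \<in> edge_trace G e U" "t \<in> {s<..<s'}"
    "s \<in> {0..1} - edge_trace G e U" "s' \<in> {0..1} - edge_trace G e U"
  shows "U \<subseteq> edge_point G e ` {s<..<s'}"
proof -
  let ?O = "edge_point G e ` {s<..<s'}" and ?S = "edge_segment G e s s'"
  have s: "0 \<le> s" "s' \<le> 1" using assms(5,6) by auto
  have not_in: "edge_point G e s \<notin> U" "edge_point G e s' \<notin> U"
    using assms(5,6) by (simp_all add: edge_trace_def)
  have trace: "edge_trace G e' ?O = (if e' = e then {s<..<s'} else {})" for e'
  proof -
    have "t \<in> {0..1} \<and> edge_point G e' t \<in> ?O \<longleftrightarrow> e' = e \<and> t \<in> {s<..<s'}" for t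
    proof
      assume "t \<in> {0..1} \<and> edge_point G e' t \<in> ?O"
      then obtain u where "edge_point G e' t = edge_point G e u" "u \<in> {s<..<s'}" by auto
      then show "e' = e \<and> t \<in> {s<..<s'}"
        using edge_point_eqD[of G e' t e u] s by auto
    qed (use s in auto)
    then show ?thesis by (simp add: edge_trace_def set_eq_iff)
  qed
  have "?O \<subseteq> graph_points G"
    using edge_segment_subset[OF assms(2) s] by (auto simp: edge_segment_def)
  moreover have "openin (top_of_set {0..1}) {s<..<s'}"
    using s by (intro open_subset) auto
  ultimately have "openin (graph_topology G) ?O"
    unfolding openin_graph_topology trace by simp
  moreover have "openin (graph_topology G) (graph_points G - ?S)"
    using closedin_edge_segment[OF assms(2) s] unfolding topspace_graph_topology[OF wf_digraph_axioms, symmetric]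
    by (simp add: openin_diff)
  moreover have U: "U \<subseteq> graph_points G" "connectedin (graph_topology G) U"
    using assms(1) closedin_subset[of "graph_topology G" U]
    by (simp_all add: closed_connected_sets_def topspace_graph_topology[OF wf_digraph_axioms])
  moreover have cover: "U \<subseteq> ?O \<union> (graph_points G - ?S)"
  proof
    fix x assume "x \<in> U"
    moreover have "x \<in> ?O" if "x \<in> ?S"
    proof -
      from that obtain u where u: "x = edge_point G e u" "u \<in> {s..s'}"
        by (auto simp: edge_segment_def)
      with \<open>x \<in> U\<close> not_in have "u \<noteq> s" "u \<noteq> s'" by auto
      with u show ?thesis by auto
    qed
    ultimately show "x \<in> ?O \<union> (graph_points G - ?S)"
      using U(1) by blast
  qed
  moreover have "?O \<inter> (graph_points G - ?S) \<inter> U = {}"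
    by (auto simp: edge_segment_def)
  moreover have "?O \<inter> U \<noteq> {}"
    using assms(3,4) unfolding edge_trace_def by blast
  ultimately have "(graph_points G - ?S) \<inter> U = {}"
    unfolding connectedin by meson
  with cover show ?thesis by blast
qed

lemma Union_edge_traces:
  assumes "U \<subseteq> graph_points G"
  shows "U = (\<Union>e\<in>arcs G. edge_point G e ` edge_trace G e U)"
proof
  show "U \<subseteq> (\<Union>e\<in>arcs G. edge_point G e ` edge_trace G e U)"
  proof
    fix x assume "x \<in> U"
    with assms have "x \<in> graph_points G" by blast
    then show "x \<in> (\<Union>e\<in>arcs G. edge_point G e ` edge_trace G e U)"
      by (rule graph_point_cases) (use \<open>x \<in> U\<close> in \<open>auto simp: edge_trace_def\<close>)
  qed
qed (auto simp: edge_trace_def)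

end

section \<open>The shape of closed connected sets\<close>

text \<open>
  Let \<open>S True\<close> and \<open>S False\<close> be the sets of points of \<open>T\<close> joined within \<open>T\<close> to \<open>0\<close> and to \<open>1\<close>.  Both are intervals,
  together they are \<open>T\<close>, and the closures of the nonempty ones are the required segments.
\<close>

lemma closed_end_intervals:
  fixes T :: "real set"
  assumes "closed T" "T \<subseteq> {0..1}" and ends: "\<And>t. t \<in> T \<Longrightarrow> {0..t} \<subseteq> T \<or> {t..1} \<subseteq> T"
  obtains B :: "bool set" and a b :: "bool \<Rightarrow> real"
  where "T = (\<Union>i\<in>B. {a i..b i})" "\<forall>i\<in>B. 0 \<le> a i \<and> a i \<le> b i \<and> b i \<le> 1"
proof -
  define S where "S = (\<lambda>i. {t \<in> T. if i then {0..t} \<subseteq> T else {t..1} \<subseteq> T})"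
  define B where "B = {i. S i \<noteq> {}}"
  have "topological_space_class.connected (S i)" for i
  proof (rule connectedI_interval)
    fix x y z assume xyz: "x \<in> S i" "y \<in> S i" "x \<le> z" "z \<le> y"
    then have "0 \<le> x" "y \<le> 1"
      using assms(2) by (auto simp: S_def)
    with xyz show "z \<in> S i"
      by (cases i) (auto simp: S_def subset_iff)
  qed
  then have conn: "topological_space_class.connected (closure (S i))" for i
    by (rule connected_imp_connected_closure)
  have "S i \<subseteq> {0..1}" for i
    using assms(2) by (auto simp: S_def)
  then have cl: "closure (S i) \<subseteq> {0..1}" for i
    by (intro closure_minimal) auto
  have "compact (closure (S i))" for i
    using cl[of i] by (meson bounded_closed_interval bounded_subset closed_closure compact_eq_bounded_closed)
  with conn have "\<exists>a b. closure (S i) = {a..b}" for i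
    using connected_compact_interval_1[of "closure (S i)"] by blast
  then obtain a b where ab: "\<And>i. closure (S i) = {a i..b i}"
    by metis
  show ?thesis
  proof (rule that)
    have "(\<Union>i\<in>B. {a i..b i}) \<subseteq> T"
      unfolding ab[symmetric] by (intro UN_least closure_minimal assms(1)) (auto simp: S_def)
    moreover have "T \<subseteq> (\<Union>i\<in>B. {a i..b i})"
    proof
      fix t assume "t \<in> T"
      with ends[of t] have "t \<in> S True \<or> t \<in> S False"
        by (auto simp: S_def)
      then obtain i where "t \<in> S i" by blast
      then have "i \<in> B" "t \<in> {a i..b i}"
        unfolding ab[symmetric] by (auto simp: B_def intro: closure_subset[THEN subsetD])
      then show "t \<in> (\<Union>i\<in>B. {a i..b i})"
        by (rule UN_I)
    qed
    ultimately show "T = (\<Union>i\<in>B. {a i..b i})"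
      by (rule order_antisym[rotated])
    show "\<forall>i\<in>B. 0 \<le> a i \<and> a i \<le> b i \<and> b i \<le> 1"
    proof
      fix i assume "i \<in> B"
      then obtain t where "t \<in> S i" by (auto simp: B_def)
      then have "t \<in> {a i..b i}"
        unfolding ab[symmetric] by (rule closure_subset[THEN subsetD])
      then have "a i \<le> b i" by simp
      with cl[of i] show "0 \<le> a i \<and> a i \<le> b i \<and> b i \<le> 1"
        unfolding ab by simp
    qed
  qed
qed

context metric_graph
begin

text \<open>
  Once \<open>U\<close> is confined to an open edge, a gap in its trace would again cut off a part of \<open>U\<close>.
\<close>

lemma closed_connected_inner_eq_segment:
  assumes U: "U \<in> closed_connected_sets G" and e: "e \<in> arcs G"
    and t: "t \<in> edge_trace G e U" "t \<in> {s<..<s'}"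
    and s: "s \<in> {0..1} - edge_trace G e U" "s' \<in> {0..1} - edge_trace G e U"
  obtains a b where "0 \<le> a" "a \<le> b" "b \<le> 1" "U = edge_segment G e a b"
proof -
  let ?T = "edge_trace G e U"
  note sub = closed_connected_subset_open_edge[OF U e]
  have T01: "?T \<subseteq> {0..1}"
    by (auto simp: edge_trace_def)
  have T_between: "?T \<subseteq> {x<..<y}"
    if "t' \<in> ?T" "t' \<in> {x<..<y}" "x \<in> {0..1} - ?T" "y \<in> {0..1} - ?T" for t' x y
  proof
    fix u assume "u \<in> ?T"
    then have "edge_point G e u \<in> U" by (simp add: edge_trace_def)
    with sub[OF that] obtain w where w: "edge_point G e u = edge_point G e w" "w \<in> {x<..<y}"
      by blast
    then have "w \<notin> {0, 1}" using that(3,4) by auto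
    with w edge_point_eqD[OF w(1)] show "u \<in> {x<..<y}" by auto
  qed
  have "topological_space_class.connected ?T"
  proof (rule connectedI_interval, rule ccontr)
    fix x y z assume xyz: "x \<in> ?T" "y \<in> ?T" "x \<le> z" "z \<le> y" "z \<notin> ?T"
    have "x \<in> {s<..<s'}" using T_between[OF t s] xyz(1) by blast
    moreover have "x < z" using xyz by (metis order_le_less)
    moreover have "z \<in> {0..1} - ?T"
      using xyz T01 by (auto simp: subset_iff)
    ultimately have "?T \<subseteq> {s<..<z}"
      using s(1) xyz(1) by (intro T_between) auto
    with xyz show False by auto
  qed
  moreover have "compact ?T"
    unfolding compact_eq_bounded_closed
  proof
    show "closed ?T"
      using U e by (simp add: closed_connected_sets_def closedin_graph_topology[OF wf_digraph_axioms])
    show "bounded ?T" using T01 by (rule bounded_subset[OF bounded_closed_interval])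
  qed
  ultimately obtain a b where T: "?T = {a..b}"
    using connected_compact_interval_1[of ?T] by blast
  show ?thesis
  proof (rule that)
    show "a \<le> b" using t(1) T by simp
    with T01 T show "0 \<le> a" "b \<le> 1" by simp_all
    have "edge_segment G e a b \<subseteq> U"
      unfolding edge_segment_def T[symmetric] by (auto simp: edge_trace_def)
    moreover have "U \<subseteq> edge_segment G e a b"
    proof
      fix x assume "x \<in> U"
      with sub[OF t s] obtain u where u: "x = edge_point G e u" "u \<in> {s<..<s'}" by blast
      then have "u \<in> ?T" using \<open>x \<in> U\<close> s by (simp add: edge_trace_def)
      with u(1) show "x \<in> edge_segment G e a b"
        unfolding edge_segment_def T by (rule image_eqI)
    qed
    ultimately show "U = edge_segment G e a b" by (rule order_antisym[rotated])
  qed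
qed

text \<open>
  Either \<open>U\<close> is a segment inside an open edge, or every point of \<open>U\<close> on an edge is joined within \<open>U\<close>
  to an end of that edge.  Indexing the segments by an edge and a Boolean bounds their
  number uniformly in \<open>U\<close>; the compactness argument depends on this bound.
\<close>

lemma closed_connected_eq_Union_segments:
  assumes U: "U \<in> closed_connected_sets G"
  obtains J a b where "J \<subseteq> arcs G \<times> (UNIV :: bool set)"
    "\<forall>j\<in>J. 0 \<le> a j \<and> a j \<le> b j \<and> b j \<le> 1"
    "U = (\<Union>j\<in>J. edge_segment G (fst j) (a j) (b j))"
proof (cases "\<exists>e\<in>arcs G. \<exists>t\<in>edge_trace G e U. \<exists>s\<in>{0..1} - edge_trace G e U.
    \<exists>s'\<in>{0..1} - edge_trace G e U. t \<in> {s<..<s'}")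
  case True
  then obtain e t s s' where *: "e \<in> arcs G" "t \<in> edge_trace G e U" "t \<in> {s<..<s'}"
    "s \<in> {0..1} - edge_trace G e U" "s' \<in> {0..1} - edge_trace G e U"
    by blast
  obtain a b where "0 \<le> a" "a \<le> b" "b \<le> 1" "U = edge_segment G e a b"
    by (rule closed_connected_inner_eq_segment[OF U *])
  with *(1) show ?thesis
    by (intro that[of "{(e, True)}" "\<lambda>_. a" "\<lambda>_. b"]) auto
next
  case False
  have U': "U \<subseteq> graph_points G" "\<And>e. e \<in> arcs G \<Longrightarrow> closed (edge_trace G e U)"
    using U by (simp_all add: closed_connected_sets_def closedin_graph_topology[OF wf_digraph_axioms])
  have "\<exists>B a b. edge_trace G e U = (\<Union>i\<in>B. {a i..b i}) \<and>
      (\<forall>i::bool\<in>B. 0 \<le> a i \<and> a i \<le> b i \<and> b i \<le> 1)" if e: "e \<in> arcs G" for e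
  proof -
    have "{0..t} \<subseteq> edge_trace G e U \<or> {t..1} \<subseteq> edge_trace G e U" if t: "t \<in> edge_trace G e U" for t
    proof (rule ccontr)
      assume "\<not> ?thesis"
      then obtain s s' where s: "s \<in> {0..t}" "s \<notin> edge_trace G e U" "s' \<in> {t..1}" "s' \<notin> edge_trace G e U"
        by blast
      moreover have "t \<in> {0..1}" using t by (simp add: edge_trace_def)
      moreover have "s \<noteq> t" "s' \<noteq> t" using s t by auto
      ultimately have "t \<in> {s<..<s'}" "s \<in> {0..1} - edge_trace G e U" "s' \<in> {0..1} - edge_trace G e U"
        by auto
      with False e t show False by blast
    qed
    note ends = this
    have sub: "edge_trace G e U \<subseteq> {0..1}" by (auto simp: edge_trace_def)
    obtain B :: "bool set" and a b where "edge_trace G e U = (\<Union>i\<in>B. {a i..b i})"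
      "\<forall>i\<in>B. 0 \<le> a i \<and> a i \<le> b i \<and> b i \<le> 1"
      by (rule closed_end_intervals[OF U'(2)[OF e] sub ends])
    then show ?thesis by (intro exI conjI)
  qed
  then have "\<forall>e\<in>arcs G. \<exists>B a b. edge_trace G e U = (\<Union>i\<in>B. {a i..b i}) \<and>
      (\<forall>i::bool\<in>B. 0 \<le> a i \<and> a i \<le> b i \<and> b i \<le> 1)"
    by (rule ballI)
  from bchoice[OF this] obtain B :: "'e \<Rightarrow> bool set"
    where "\<forall>e\<in>arcs G. \<exists>a b. edge_trace G e U = (\<Union>i\<in>B e. {a i..b i}) \<and>
      (\<forall>i\<in>B e. 0 \<le> a i \<and> a i \<le> b i \<and> b i \<le> 1)" ..
  from bchoice[OF this] obtain a
    where "\<forall>e\<in>arcs G. \<exists>b. edge_trace G e U = (\<Union>i\<in>B e. {a e i..b i}) \<and>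
      (\<forall>i\<in>B e. 0 \<le> a e i \<and> a e i \<le> b i \<and> b i \<le> 1)" ..
  from bchoice[OF this] obtain b
    where B: "\<forall>e\<in>arcs G. edge_trace G e U = (\<Union>i\<in>B e. {a e i..b e i}) \<and>
      (\<forall>i\<in>B e. 0 \<le> a e i \<and> a e i \<le> b e i \<and> b e i \<le> 1)" ..
  show ?thesis
  proof (rule that[of "Sigma (arcs G) B" "\<lambda>(e, i). a e i" "\<lambda>(e, i). b e i"])
    show "Sigma (arcs G) B \<subseteq> arcs G \<times> UNIV" by blast
    show "\<forall>j\<in>Sigma (arcs G) B. 0 \<le> (case j of (e, i) \<Rightarrow> a e i) \<and>
        (case j of (e, i) \<Rightarrow> a e i) \<le> (case j of (e, i) \<Rightarrow> b e i) \<and> (case j of (e, i) \<Rightarrow> b e i) \<le> 1"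
      using B by (intro ballI, elim SigmaE) simp
  next
    have "U = (\<Union>e\<in>arcs G. edge_point G e ` (\<Union>i\<in>B e. {a e i..b e i}))"
      using Union_edge_traces[OF U'(1)] B by simp
    also have "\<dots> = (\<Union>e\<in>arcs G. \<Union>i\<in>B e. edge_segment G e (a e i) (b e i))"
      by (simp only: edge_segment_def image_UN)
    also have "\<dots> = (\<Union>j\<in>Sigma (arcs G) B. edge_segment G (fst j) (case j of (e, i) \<Rightarrow> a e i) (case j of (e, i) \<Rightarrow> b e i))"
      unfolding set_eq_iff UN_iff by (simp add: Bex_def split_paired_Ex)
    finally show "U = (\<Union>j\<in>Sigma (arcs G) B. edge_segment G (fst j) (case j of (e, i) \<Rightarrow> a e i) (case j of (e, i) \<Rightarrow> b e i))" .
  qed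
qed

lemma closed_connected_imp_linked:
  assumes "(\<Union>j\<in>J. edge_segment G (e j) (a j) (b j)) \<in> closed_connected_sets G" "finite J"
    and "\<And>j. j \<in> J \<Longrightarrow> e j \<in> arcs G \<and> 0 \<le> a j \<and> a j \<le> b j \<and> b j \<le> 1"
  shows "linked J (\<lambda>j. edge_segment G (e j) (a j) (b j))"
proof (rule connectedin_Union_imp_linked)
  show "connectedin (graph_topology G) (\<Union>j\<in>J. edge_segment G (e j) (a j) (b j))"
    using assms(1) by (simp add: closed_connected_sets_def)
qed (use assms(2,3) in \<open>simp_all add: closedin_edge_segment, simp add: edge_segment_def\<close>)

text \<open>
  With \<open>grown_closed_connected\<close>, this identifies the closed connected sets containing \<open>p\<close> with the
  sets grown from \<open>p\<close>, and makes induction over them available.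
\<close>

lemma closed_connected_imp_grown:
  assumes U: "U \<in> closed_connected_sets G" and "p \<in> U"
  shows "grown G p U"
proof -
  obtain J a b where J: "J \<subseteq> arcs G \<times> (UNIV :: bool set)"
    and ab: "\<forall>j\<in>J. 0 \<le> a j \<and> a j \<le> b j \<and> b j \<le> 1"
    and U_eq: "U = (\<Union>j\<in>J. edge_segment G (fst j) (a j) (b j))"
    by (rule closed_connected_eq_Union_segments[OF U])
  have "finite J"
    using J by (rule finite_subset) simp
  have e: "fst j \<in> arcs G" if "j \<in> J" for j
    using J that by auto
  have "U \<subseteq> graph_points G"
    using U by (simp add: closed_connected_sets_def closedin_graph_topology[OF wf_digraph_axioms])
  moreover have "linked J (\<lambda>j. edge_segment G (fst j) (a j) (b j))"
    using U \<open>finite J\<close> ab e unfolding U_eq by (intro closed_connected_imp_linked) simp_all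
  ultimately show ?thesis
    using \<open>finite J\<close> \<open>p \<in> U\<close> ab e unfolding U_eq by (intro linked_imp_grown) auto
qed

end

section \<open>Exhaustions by closed connected sets\<close>

lemma lipschitz_IVT:
  fixes g :: "real \<Rightarrow> real"
  assumes "a \<le> b" "g a \<le> y" "y \<le> g b" "L \<ge> 0"
    and lip: "\<And>s t. a \<le> s \<Longrightarrow> s \<le> t \<Longrightarrow> t \<le> b \<Longrightarrow> \<bar>g t - g s\<bar> \<le> L * (t - s)"
  obtains s where "s \<in> {a..b}" "g s = y"
proof -
  have "L-lipschitz_on {a..b} g"
  proof (rule lipschitz_onI)
    fix s t assume "s \<in> {a..b}" "t \<in> {a..b}"
    then show "dist (g s) (g t) \<le> L * dist s t"
      using lip[of s t] lip[of t s] by (cases "s \<le> t") (simp_all add: dist_real_def abs_minus_commute)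
  qed (rule \<open>L \<ge> 0\<close>)
  then have "continuous_on {a..b} g"
    by (rule lipschitz_on_continuous_on)
  from IVT'[OF assms(2,3,1) this] that show ?thesis by auto
qed

context metric_graph
begin

abbreviation \<mu> where "\<mu> \<equiv> measure (graph_measure G)"

sublocale gm: finite_measure "graph_measure G"
  by (rule finite_measure_graph_measure)

lemma closed_connected_sets_sets:
  "U \<in> closed_connected_sets G \<Longrightarrow> U \<in> sets (graph_measure G)"
  by (simp add: closed_connected_sets_def closedin_imp_sets_graph_measure)

lemma closed_connected_sets_Un:
  assumes "U \<in> closed_connected_sets G" "V \<in> closed_connected_sets G" "p \<in> U" "p \<in> V"
  shows "U \<union> V \<in> closed_connected_sets G"
proof -
  have "U \<inter> V \<noteq> {}" using assms(3,4) by blast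
  then show ?thesis
    using assms(1,2) by (simp add: closed_connected_sets_def connectedin_Un closedin_Un)
qed

lemma closed_connected_sets_subset: "U \<in> closed_connected_sets G \<Longrightarrow> U \<subseteq> graph_points G"
  by (simp add: closed_connected_sets_def closedin_graph_topology[OF wf_digraph_axioms])

lemma measure_le_measure_plus_diff:
  assumes "A \<in> sets (graph_measure G)" "B \<in> sets (graph_measure G)"
  shows "\<mu> A \<le> \<mu> B + \<mu> (A - B)"
proof -
  have "\<mu> A \<le> \<mu> (B \<union> (A - B))"
    using assms by (intro gm.finite_measure_mono) auto
  also have "\<dots> \<le> \<mu> B + \<mu> (A - B)"
    using assms by (intro measure_subadditive) auto
  finally show ?thesis .
qed

lemma edge_segment_sets:
  "e \<in> arcs G \<Longrightarrow> 0 \<le> a \<Longrightarrow> b \<le> 1 \<Longrightarrow> edge_segment G e a b \<in> sets (graph_measure G)"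
  by (rule closedin_imp_sets_graph_measure[OF closedin_edge_segment])

text \<open>
  The difference of two intervals is covered by the two intervals between corresponding
  endpoints.
\<close>

lemma measure_edge_segment_diff_le:
  assumes "e \<in> arcs G" "a \<in> {0..1}" "b \<in> {0..1}" "a' \<in> {0..1}" "b' \<in> {0..1}"
  shows "\<mu> (edge_segment G e a b - edge_segment G e a' b') \<le> \<bar>a - a'\<bar> + \<bar>b - b'\<bar>"
proof -
  let ?L = "edge_segment G e (min a a') (max a a')" and ?R = "edge_segment G e (min b b') (max b b')"
  have sets: "?L \<in> sets (graph_measure G)" "?R \<in> sets (graph_measure G)"
    using assms by (auto intro!: edge_segment_sets)
  have "{a..b} - {a'..b'} \<subseteq> {min a a'..max a a'} \<union> {min b b'..max b b'}"
    by auto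
  then have "edge_segment G e a b - edge_segment G e a' b' \<subseteq> ?L \<union> ?R"
    unfolding edge_segment_def image_Un[symmetric] by blast
  then have "\<mu> (edge_segment G e a b - edge_segment G e a' b') \<le> \<mu> (?L \<union> ?R)"
    using sets by (intro gm.finite_measure_mono) auto
  also have "\<dots> \<le> \<mu> ?L + \<mu> ?R"
    using sets by (intro measure_subadditive) auto
  also have "\<mu> ?L = max a a' - min a a'"
    using assms by (intro measure_edge_segment) auto
  also have "\<mu> ?R = max b b' - min b b'"
    using assms by (intro measure_edge_segment) auto
  finally show ?thesis by (simp add: max_def min_def split: if_splits)
qed

lemma measure_point:
  assumes "p \<in> graph_points G"
  shows "\<mu> {p} = 0"
proof -
  obtain e t where "e \<in> arcs G" "t \<in> {0..1}" "p = edge_point G e t"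
    using assms by (rule graph_point_cases)
  then show ?thesis
    using measure_edge_segment[of e t t] by (simp add: edge_segment_def)
qed

text \<open>
  Scaling the new segment by \<open>s\<close> towards the point \<open>c\<close> of attachment keeps it attached, and the
  measure of the union depends on \<open>s\<close> in a Lipschitz way; hence it takes all values between its
  values at the two stages.
\<close>

lemma grown_sweep:
  assumes K: "grown G p K" and seg: "e \<in> arcs G" "0 \<le> a" "b \<le> 1" "c \<in> {a..b}" "edge_point G e c \<in> K"
    and t: "\<mu> K \<le> t" "t \<le> \<mu> (K \<union> edge_segment G e a b)"
  obtains s where "s \<in> {0..1}" "\<mu> (K \<union> edge_segment G e (c - s * (c - a)) (c + s * (b - c))) = t"
proof -
  let ?J = "\<lambda>s. edge_segment G e (c - s * (c - a)) (c + s * (b - c))"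
  have in01: "c - s * (c - a) \<in> {0..1}" "c + s * (b - c) \<in> {0..1}" if "0 \<le> s" "s \<le> 1" for s
  proof -
    have "s * (c - a) \<le> c - a" "s * (b - c) \<le> b - c" "0 \<le> s * (c - a)" "0 \<le> s * (b - c)"
      using that seg(4) by (simp_all add: mult_left_le_one_le)
    with seg(2-4) show "c - s * (c - a) \<in> {0..1}" "c + s * (b - c) \<in> {0..1}" by auto
  qed
  have K_sets: "K \<in> sets (graph_measure G)"
    using grown_closed_connected[OF K] by (rule closed_connected_sets_sets)
  have J_sets: "?J s \<in> sets (graph_measure G)" if "0 \<le> s" "s \<le> 1" for s
    using in01[OF that] by (intro edge_segment_sets seg(1)) auto
  have half: "\<mu> (K \<union> ?J s) - \<mu> (K \<union> ?J s') \<le> \<bar>s - s'\<bar>"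
    if s: "0 \<le> s" "s \<le> 1" "0 \<le> s'" "s' \<le> 1" for s s'
  proof -
    have "\<mu> (K \<union> ?J s) \<le> \<mu> (K \<union> ?J s') + \<mu> (K \<union> ?J s - (K \<union> ?J s'))"
      using K_sets J_sets s by (intro measure_le_measure_plus_diff) auto
    also have "\<mu> (K \<union> ?J s - (K \<union> ?J s')) \<le> \<mu> (?J s - ?J s')"
      using J_sets s by (intro gm.finite_measure_mono) auto
    also have "\<dots> \<le> \<bar>(c - s * (c - a)) - (c - s' * (c - a))\<bar> + \<bar>(c + s * (b - c)) - (c + s' * (b - c))\<bar>"
      using in01 s by (intro measure_edge_segment_diff_le seg(1)) simp_all
    also have "\<dots> = \<bar>(s' - s) * (c - a)\<bar> + \<bar>(s - s') * (b - c)\<bar>"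
      by (simp add: algebra_simps)
    also have "\<dots> = \<bar>s - s'\<bar> * (c - a) + \<bar>s - s'\<bar> * (b - c)"
      using seg(4) by (simp add: abs_mult abs_minus_commute)
    also have "\<dots> = \<bar>s - s'\<bar> * (b - a)"
      by (simp add: distrib_left[symmetric])
    also have "\<dots> \<le> \<bar>s - s'\<bar>"
      using seg(2-4) by (intro mult_left_le) auto
    finally show ?thesis by simp
  qed
  have "edge_point G e ` {c} \<subseteq> K" using seg(5) by simp
  then have J0: "K \<union> ?J 0 = K" by (simp add: edge_segment_def insert_absorb)
  have J1: "?J 1 = edge_segment G e a b" by simp
  show ?thesis
  proof (rule lipschitz_IVT[of 0 1 "\<lambda>s. \<mu> (K \<union> ?J s)" t 1])
    show "\<mu> (K \<union> ?J 0) \<le> t" using t(1) unfolding J0 .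
    show "t \<le> \<mu> (K \<union> ?J 1)" using t(2) unfolding J1 .
    fix s s' :: real assume "0 \<le> s" "s \<le> s'" "s' \<le> 1"
    then show "\<bar>\<mu> (K \<union> ?J s') - \<mu> (K \<union> ?J s)\<bar> \<le> 1 * (s' - s)"
      using half[of s s'] half[of s' s] by (simp add: abs_le_iff)
  qed (use that in auto)
qed

text \<open>
  A chain of closed connected sets that realises all measures from 0 to that of \<open>K\<close>.  In the
  inductive step, the chain for \<open>K\<close> provides the measures up to that of \<open>K\<close>, and the sweep of the
  attached segment the larger ones.  Working with a chain rather than with a parametrised
  family means that the two stages only have to be united.
\<close>

lemma grown_chain:
  assumes "grown G p K"
  shows "\<exists>C. (\<forall>X\<in>C. X \<in> closed_connected_sets G \<and> p \<in> X \<and> X \<subseteq> K) \<and>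
    (\<forall>X\<in>C. \<forall>Y\<in>C. X \<subseteq> Y \<or> Y \<subseteq> X) \<and> (\<forall>t\<in>{0..\<mu> K}. \<exists>X\<in>C. \<mu> X = t)"
  using assms
proof (induction rule: grown.induct)
  case point
  then have "{p} \<in> closed_connected_sets G"
    by (intro grown_closed_connected[of p] grown.point)
  with measure_point[OF point] show ?case
    by (intro exI[of _ "{{p}}"]) simp
next
  case (attach K e a b c)
  let ?J = "\<lambda>s. edge_segment G e (c - s * (c - a)) (c + s * (b - c))"
  obtain C where C: "\<forall>X\<in>C. X \<in> closed_connected_sets G \<and> p \<in> X \<and> X \<subseteq> K"
    "\<forall>X\<in>C. \<forall>Y\<in>C. X \<subseteq> Y \<or> Y \<subseteq> X" "\<forall>t\<in>{0..\<mu> K}. \<exists>X\<in>C. \<mu> X = t"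
    using attach.IH by (elim exE conjE)
  have J_mono: "?J s \<subseteq> ?J s'" if "s \<le> s'" for s s'
  proof -
    have "s * (c - a) \<le> s' * (c - a)" "s * (b - c) \<le> s' * (b - c)"
      using that attach.hyps(5) by (simp_all add: mult_right_mono)
    then show ?thesis
      unfolding edge_segment_def by (intro image_mono) auto
  qed
  have J1: "?J 1 = edge_segment G e a b" by simp
  have in_J: "c \<in> {c - s * (c - a)..c + s * (b - c)}" if "0 \<le> s" for s
    using that attach.hyps(5) by simp
  define C' where "C' = C \<union> (\<lambda>s. K \<union> ?J s) ` {0..1}"
  have new: "K \<union> ?J s \<in> closed_connected_sets G \<and> p \<in> K \<union> ?J s \<and> K \<union> ?J s \<subseteq> K \<union> edge_segment G e a b"
    if s: "s \<in> {0..1}" for s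
  proof (intro conjI)
    have sub: "?J s \<subseteq> edge_segment G e a b"
      using J_mono[of s 1] s unfolding J1 by simp
    have "s * (c - a) \<le> c - a" "s * (b - c) \<le> b - c"
      using s attach.hyps(5) by (simp_all add: mult_left_le_one_le)
    then have "grown G p (K \<union> ?J s)"
      using attach.hyps s in_J[of s] by (intro grown.attach[where c = c]) auto
    then show "K \<union> ?J s \<in> closed_connected_sets G" "p \<in> K \<union> ?J s"
      by (rule grown_closed_connected, rule grown_root_mem)
    show "K \<union> ?J s \<subseteq> K \<union> edge_segment G e a b"
      using sub by blast
  qed
  show ?case
  proof (intro exI conjI ballI)
    fix X assume "X \<in> C'"
    then consider "X \<in> C" | s where "s \<in> {0..1}" "X = K \<union> ?J s"
      unfolding C'_def by blast
    then have "X \<in> closed_connected_sets G \<and> p \<in> X \<and> X \<subseteq> K \<union> edge_segment G e a b"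
    proof cases
      case 1
      then show ?thesis using C(1) by blast
    next
      case 2
      then show ?thesis using new by simp
    qed
    then show "X \<in> closed_connected_sets G" "p \<in> X" "X \<subseteq> K \<union> edge_segment G e a b"
      by simp_all
  next
    fix X Y assume XY: "X \<in> C'" "Y \<in> C'"
    from XY(1) consider "X \<in> C" | s where "s \<in> {0..1}" "X = K \<union> ?J s"
      unfolding C'_def by blast
    note X = this
    from XY(2) consider "Y \<in> C" | s where "s \<in> {0..1}" "Y = K \<union> ?J s"
      unfolding C'_def by blast
    note Y = this
    from X show "X \<subseteq> Y \<or> Y \<subseteq> X"
    proof cases
      case 1
      from Y show ?thesis
      proof cases
        case 1
        with \<open>X \<in> C\<close> C(2) show ?thesis by blast
      next
        case 2
        have "X \<subseteq> K" using C(1) \<open>X \<in> C\<close> by blast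
        with 2 show ?thesis by blast
      qed
    next
      case (2 s)
      from Y show ?thesis
      proof cases
        case 1
        then have "Y \<subseteq> K" using C(1) by blast
        with 2 show ?thesis by blast
      next
        case (2 s')
        with \<open>X = K \<union> ?J s\<close> J_mono[of s s'] J_mono[of s' s] show ?thesis
          by (cases "s \<le> s'") (simp_all, blast+)
      qed
    qed
  next
    fix t assume t: "t \<in> {0..\<mu> (K \<union> edge_segment G e a b)}"
    show "\<exists>X\<in>C'. \<mu> X = t"
    proof (cases "t \<le> \<mu> K")
      case True
      with t C(3) show ?thesis unfolding C'_def by (meson UnI1 atLeastAtMost_iff)
    next
      case False
      with t have "\<mu> K \<le> t" "t \<le> \<mu> (K \<union> edge_segment G e a b)" by simp_all
      then obtain s where "s \<in> {0..1}" "\<mu> (K \<union> ?J s) = t"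
        by (rule grown_sweep[OF attach.hyps(1-6)])
      then show ?thesis
        unfolding C'_def by blast
    qed
  qed
qed

text \<open>
  A path from \<open>p\<close> to \<open>K\<close> through closed connected sets, parametrised by measure.  Its last set
  agrees with \<open>K\<close> up to a null set only.
\<close>

definition exhaustion where
  "exhaustion p K A \<longleftrightarrow>
    (\<forall>t\<in>{0..\<mu> K}. A t \<in> closed_connected_sets G \<and> p \<in> A t \<and> A t \<subseteq> K \<and> \<mu> (A t) = t) \<and>
    (\<forall>s t. 0 \<le> s \<longrightarrow> s \<le> t \<longrightarrow> t \<le> \<mu> K \<longrightarrow> A s \<subseteq> A t)"

lemma exhaustionD:
  assumes "exhaustion p K A" "0 \<le> t" "t \<le> \<mu> K"
  shows "A t \<in> closed_connected_sets G" "p \<in> A t" "A t \<subseteq> K" "\<mu> (A t) = t"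
    "A t \<in> sets (graph_measure G)" "\<And>s. 0 \<le> s \<Longrightarrow> s \<le> t \<Longrightarrow> A s \<subseteq> A t"
  using assms by (simp_all add: exhaustion_def closed_connected_sets_sets)

text \<open>
  Pick from the chain one set of each measure.  Of two comparable sets the one with smaller
  measure has to be the smaller set, so the choice is automatically monotone.
\<close>

lemma exhaustion_exists:
  assumes "K \<in> closed_connected_sets G" "p \<in> K"
  obtains A where "exhaustion p K A"
proof -
  obtain C where C: "\<forall>X\<in>C. X \<in> closed_connected_sets G \<and> p \<in> X \<and> X \<subseteq> K"
    "\<forall>X\<in>C. \<forall>Y\<in>C. X \<subseteq> Y \<or> Y \<subseteq> X" "\<forall>t\<in>{0..\<mu> K}. \<exists>X\<in>C. \<mu> X = t"
    using grown_chain[OF closed_connected_imp_grown[OF assms]] by (elim exE conjE)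
  from C(3) have "\<forall>t\<in>{0..\<mu> K}. \<exists>X. X \<in> C \<and> \<mu> X = t"
    by blast
  from bchoice[OF this] obtain A where A: "\<forall>t\<in>{0..\<mu> K}. A t \<in> C \<and> \<mu> (A t) = t" ..
  have "A s \<subseteq> A t" if "0 \<le> s" "s \<le> t" "t \<le> \<mu> K" for s t
  proof (rule ccontr)
    assume not: "\<not> A s \<subseteq> A t"
    have *: "A s \<in> C" "A t \<in> C" "\<mu> (A s) = s" "\<mu> (A t) = t"
      using A that by simp_all
    with C(2) not have "A t \<subseteq> A s" by blast
    then have "\<mu> (A t) \<le> \<mu> (A s)"
      using *(1) C(1) closed_connected_sets_sets by (intro gm.finite_measure_mono) simp_all
    with that(2) * have "s = t" by simp
    with not show False by simp
  qed
  with A C(1) have "exhaustion p K A"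
    unfolding exhaustion_def by simp
  then show ?thesis by (rule that)
qed

lemma measure_exhaustion_diff:
  assumes "exhaustion p K A" "0 \<le> s" "s \<le> t" "t \<le> \<mu> K"
  shows "\<mu> (A t - A s) = t - s"
  using assms exhaustionD[OF assms(1), of s] exhaustionD[OF assms(1), of t]
  by (simp add: gm.finite_measure_Diff)

text \<open>
  Because the measure of \<open>A t - A s\<close> is \<open>t - s\<close>, the measure of \<open>A s \<union> B\<close> varies continuously, from that
  of \<open>B\<close> to that of \<open>K \<union> B\<close>.
\<close>

lemma exhaustion_fill:
  assumes A: "exhaustion p K A" and K: "K \<in> sets (graph_measure G)"
    and B: "B \<in> sets (graph_measure G)" and r: "\<mu> B \<le> r" "r \<le> \<mu> (K \<union> B)"
  obtains s where "s \<in> {0..\<mu> K}" "\<mu> (A s \<union> B) = r"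
proof -
  have sets: "A s \<in> sets (graph_measure G)" if "0 \<le> s" "s \<le> \<mu> K" for s
    using exhaustionD[OF A that] by simp
  show ?thesis
  proof (rule lipschitz_IVT[of 0 "\<mu> K" "\<lambda>s. \<mu> (A s \<union> B)" r 1])
    have "\<mu> (A 0 \<union> B) \<le> \<mu> (A 0) + \<mu> B"
      using sets B by (intro measure_subadditive) auto
    with exhaustionD(4)[OF A, of 0] r(1) show "\<mu> (A 0 \<union> B) \<le> r"
      by simp
    have "\<mu> (K \<union> B) \<le> \<mu> (A (\<mu> K) \<union> B) + \<mu> (K \<union> B - (A (\<mu> K) \<union> B))"
      using sets B K by (intro measure_le_measure_plus_diff) auto
    also have "\<mu> (K \<union> B - (A (\<mu> K) \<union> B)) \<le> \<mu> (K - A (\<mu> K))"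
      using sets K by (intro gm.finite_measure_mono) auto
    also have "\<dots> = 0"
      using exhaustionD[OF A, of "\<mu> K"] K by (simp add: gm.finite_measure_Diff)
    finally show "r \<le> \<mu> (A (\<mu> K) \<union> B)"
      using r(2) by simp
    fix s t assume st: "0 \<le> s" "s \<le> t" "t \<le> \<mu> K"
    have "A s \<subseteq> A t" using exhaustionD(6)[OF A _ st(3)] st by simp
    then have "\<mu> (A s \<union> B) \<le> \<mu> (A t \<union> B)"
      using sets B st by (intro gm.finite_measure_mono) auto
    moreover have "\<mu> (A t \<union> B) \<le> \<mu> (A s \<union> B) + \<mu> (A t \<union> B - (A s \<union> B))"
      using sets B st by (intro measure_le_measure_plus_diff) auto
    moreover have "\<mu> (A t \<union> B - (A s \<union> B)) \<le> \<mu> (A t - A s)"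
      using sets B st by (intro gm.finite_measure_mono) auto
    moreover have "\<mu> (A t - A s) = t - s"
      by (rule measure_exhaustion_diff[OF A st])
    ultimately show "\<bar>\<mu> (A t \<union> B) - \<mu> (A s \<union> B)\<bar> \<le> 1 * (t - s)"
      by simp
  qed (use that in simp_all)
qed

lemma graph_points_closed_connected: "graph_points G \<in> closed_connected_sets G"
proof -
  obtain e where "e \<in> arcs G" using arcs_nonempty by blast
  then have "edge_point G e 0 \<in> graph_points G"
    by (intro edge_point_in_graph_points[OF wf_digraph_axioms]) auto
  then show ?thesis
    by (rule grown_closed_connected[OF grown_graph_points])
qed

text \<open>
  Unite \<open>K\<close> with the sets of an exhaustion of the whole graph that starts in a point of \<open>K\<close>.
\<close>

lemma extend_closed_connected:
  assumes K: "K \<in> closed_connected_sets G" and r: "\<mu> K \<le> r" "r \<le> \<mu> (graph_points G)"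
  obtains U where "U \<in> closed_connected_sets_of_measure G r" "K \<subseteq> U"
proof -
  obtain p where "p \<in> K" using K by (auto simp: closed_connected_sets_def)
  with closed_connected_sets_subset[OF K] have "p \<in> graph_points G" by blast
  then obtain A where A: "exhaustion p (graph_points G) A"
    by (rule exhaustion_exists[OF graph_points_closed_connected])
  have "graph_points G \<union> K = graph_points G"
    using closed_connected_sets_subset[OF K] by blast
  with r have "\<mu> K \<le> r" "r \<le> \<mu> (graph_points G \<union> K)" by simp_all
  then obtain s where s: "s \<in> {0..\<mu> (graph_points G)}" "\<mu> (A s \<union> K) = r"
    by (rule exhaustion_fill[OF A closed_connected_sets_sets[OF graph_points_closed_connected]
          closed_connected_sets_sets[OF K]])
  then have "A s \<union> K \<in> closed_connected_sets G"
    using exhaustionD[OF A, of s] K \<open>p \<in> K\<close> by (intro closed_connected_sets_Un) simp_all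
  with s show ?thesis
    by (intro that[of "A s \<union> K"]) (auto simp: closed_connected_sets_of_measure_def)
qed

end

section \<open>Zeros between two sets with a common point\<close>

context metric_graph
begin

text \<open>
  Riemann integrable functions on the edges are measurable for the completed Lebesgue measure,
  because they are Henstock-Kurzweil integrable.
\<close>

lemma L1_graph_measurable:
  assumes "f \<in> L1_graph G"
  shows "f \<in> borel_measurable (graph_measure G)"
proof (rule measurableI)
  fix S :: "real set" assume S: "S \<in> sets borel"
  have "edge_trace G e (f -` S \<inter> graph_points G) \<in> sets lebesgue" if e: "e \<in> arcs G" for e
  proof -
    let ?g = "\<lambda>t. f (edge_point G e t)"
    have "?g integrable_on {0..1}"
      using assms e by (intro riemann_integrable_imp_integrable_on) (simp add: L1_graph_def)
    then have "?g \<in> borel_measurable (lebesgue_on {0..1})"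
      by (rule integrable_imp_measurable)
    from measurable_sets[OF this S] have "?g -` S \<inter> {0..1} \<in> sets lebesgue"
      by (simp add: sets_restrict_space_iff space_restrict_space)
    moreover have "edge_trace G e (f -` S \<inter> graph_points G) = ?g -` S \<inter> {0..1}"
      using edge_point_in_graph_points[OF wf_digraph_axioms e] by (auto simp: edge_trace_def)
    ultimately show ?thesis by simp
  qed
  then show "f -` S \<inter> space (graph_measure G) \<in> sets (graph_measure G)"
    by (simp add: sets_graph_measure[OF wf_digraph_axioms] space_graph_measure)
qed simp

lemma L1_graph_bounded:
  assumes "f \<in> L1_graph G"
  obtains B where "\<forall>x\<in>graph_points G. \<bar>f x\<bar> \<le> B"
proof -
  have "\<forall>e\<in>arcs G. \<exists>B. \<forall>t\<in>{0..1}. \<bar>f (edge_point G e t)\<bar> \<le> B"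
    using assms by (intro ballI riemann_integrable_imp_bounded) (simp_all add: L1_graph_def)
  from bchoice[OF this] obtain B where B: "\<forall>e\<in>arcs G. \<forall>t\<in>{0..1}. \<bar>f (edge_point G e t)\<bar> \<le> B e" ..
  show ?thesis
  proof (rule that, rule ballI)
    fix x assume "x \<in> graph_points G"
    then obtain e t where x: "e \<in> arcs G" "t \<in> {0..1}" "x = edge_point G e t"
      by (rule graph_point_cases)
    with B have "\<bar>f x\<bar> \<le> B e" by simp
    also have "\<dots> \<le> \<bar>B e\<bar>" by simp
    also have "\<dots> \<le> (\<Sum>e\<in>arcs G. \<bar>B e\<bar>)"
      using x(1) by (intro member_le_sum) simp_all
    finally show "\<bar>f x\<bar> \<le> (\<Sum>e\<in>arcs G. \<bar>B e\<bar>)" .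
  qed
qed

end

locale bounded_graph_function = metric_graph G for G :: "('v, 'e) pre_digraph" +
  fixes f :: "('v, 'e) gpoint \<Rightarrow> real" and B :: real
  assumes measurable_f: "f \<in> borel_measurable (graph_measure G)"
    and bounded_f: "\<And>x. x \<in> graph_points G \<Longrightarrow> \<bar>f x\<bar> \<le> B"
begin

abbreviation I where "I U \<equiv> (LINT x:U|graph_measure G. f x)"

lemma B_nonneg: "0 \<le> B"
proof -
  obtain p where "p \<in> graph_points G"
    using graph_points_closed_connected by (auto simp: closed_connected_sets_def)
  from bounded_f[OF this] show ?thesis by simp
qed

lemma integrable_f: "integrable (graph_measure G) f"
  using bounded_f by (intro gm.integrable_const_bound[where B = B] measurable_f)
    (auto simp: space_graph_measure)

lemma set_integrable_f: "U \<in> sets (graph_measure G) \<Longrightarrow> set_integrable (graph_measure G) U f"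
  using integrable_f unfolding set_integrable_def by (intro integrable_mult_indicator) simp_all

lemma abs_integral_le:
  assumes "U \<in> sets (graph_measure G)"
  shows "\<bar>I U\<bar> \<le> B * \<mu> U"
proof -
  have "norm (I U) \<le> (LINT x:U|graph_measure G. norm (f x))"
    by (rule set_integral_norm_bound[OF set_integrable_f[OF assms]])
  also have "\<dots> \<le> (LINT x:U|graph_measure G. B)"
  proof (rule set_integral_mono)
    show "set_integrable (graph_measure G) U (\<lambda>x. norm (f x))"
      by (rule set_integrable_norm[OF set_integrable_f[OF assms]])
    show "set_integrable (graph_measure G) U (\<lambda>x. B)"
      unfolding set_integrable_def using assms
      by (intro integrable_mult_indicator) simp_all
    fix x assume "x \<in> U"
    then have "x \<in> graph_points G"
      using sets.sets_into_space[OF assms] by (auto simp: space_graph_measure)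
    then show "norm (f x) \<le> B" using bounded_f by simp
  qed
  also have "\<dots> = B * \<mu> U"
    using assms by (simp add: set_lebesgue_integral_def)
  finally show ?thesis by simp
qed

lemma abs_integral_diff_le:
  assumes "U \<in> sets (graph_measure G)" "V \<in> sets (graph_measure G)"
  shows "\<bar>I U - I V\<bar> \<le> B * (\<mu> (U - V) + \<mu> (V - U))"
proof -
  have split: "I U = I (U \<inter> V) + I (U - V)"
    if "U \<in> sets (graph_measure G)" "V \<in> sets (graph_measure G)" for U V
  proof -
    have "I ((U \<inter> V) \<union> (U - V)) = I (U \<inter> V) + I (U - V)"
      using that by (intro set_integral_Un set_integrable_f) auto
    then show ?thesis by (simp add: Int_Diff_Un)
  qed
  have "I U - I V = I (U - V) - I (V - U)"
    using split[OF assms] split[OF assms(2,1)] by (simp add: Int_commute)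
  then show ?thesis
    using abs_integral_le[of "U - V"] abs_integral_le[of "V - U"] assms
    by (simp add: distrib_left)
qed

text \<open>
  For sets of equal measure the two one-sided differences have equal measure, so that it is
  enough to control one of them.
\<close>

lemma abs_integral_diff_le_equal_measure:
  assumes "U \<in> sets (graph_measure G)" "V \<in> sets (graph_measure G)" "\<mu> U = \<mu> V"
  shows "\<bar>I U - I V\<bar> \<le> 2 * B * \<mu> (U - V)"
proof -
  have "\<mu> (U - V) = \<mu> (V - U)"
    using assms by (simp add: gm.finite_measure_Diff' Int_commute)
  with abs_integral_diff_le[OF assms(1,2)] show ?thesis by simp
qed

text \<open>
  The intermediate value argument.  Let \<open>S\<close> and \<open>T\<close> exhaust \<open>U\<close> and \<open>V\<close> from \<open>p\<close>, and for each \<open>t\<close> choose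
  \<open>\<sigma> t\<close> such that \<open>W t = S (\<sigma> t) \<union> T t\<close> has measure \<open>r\<close>.  Although \<open>\<sigma>\<close> is an arbitrary choice, \<open>W\<close> moves
  continuously.  For \<open>s \<le> t\<close> there are two cases: if \<open>\<sigma> s \<le> \<sigma> t\<close>, then \<open>W s \<subseteq> W t\<close>, and as both have measure \<open>r\<close>
  they agree up to a null set; otherwise \<open>W t - W s\<close> is contained in \<open>T t - T s\<close>, which has measure
  \<open>t - s\<close>.  In both cases the integral changes by at most \<open>2 * B * (t - s)\<close>.  The same
  comparison shows that \<open>W 0\<close> and \<open>W r\<close> have the integrals of \<open>U\<close> and \<open>V\<close>.
\<close>

lemma zero_between:
  assumes U: "U \<in> closed_connected_sets_of_measure G r" and V: "V \<in> closed_connected_sets_of_measure G r"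
    and p: "p \<in> U" "p \<in> V" and sign: "0 \<le> I U" "I V \<le> 0"
  obtains W where "W \<in> closed_connected_sets_of_measure G r" "I W = 0"
proof -
  from U V have ccs: "U \<in> closed_connected_sets G" "V \<in> closed_connected_sets G"
    and r: "\<mu> U = r" "\<mu> V = r"
    by (simp_all add: closed_connected_sets_of_measure_def)
  note UV_sets = ccs[THEN closed_connected_sets_sets]
  obtain S where S: "exhaustion p U S" by (rule exhaustion_exists[OF ccs(1) p(1)])
  obtain T where T: "exhaustion p V T" by (rule exhaustion_exists[OF ccs(2) p(2)])
  note SD = exhaustionD[OF S, unfolded r] and TD = exhaustionD[OF T, unfolded r]
  have "0 \<le> r" using r by (metis measure_nonneg)
  have "\<forall>t\<in>{0..r}. \<exists>s. s \<in> {0..r} \<and> \<mu> (S s \<union> T t) = r"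
  proof
    fix t assume t: "t \<in> {0..r}"
    then have "\<mu> (T t) \<le> r" using TD(4)[of t] by simp
    moreover have "\<mu> U \<le> \<mu> (U \<union> T t)"
      using UV_sets TD(5)[of t] t by (intro gm.finite_measure_mono) auto
    then have "r \<le> \<mu> (U \<union> T t)" using r by simp
    moreover have "T t \<in> sets (graph_measure G)" using t TD(5)[of t] by simp
    ultimately obtain s where "s \<in> {0..\<mu> U}" "\<mu> (S s \<union> T t) = r"
      using exhaustion_fill[OF S UV_sets(1)] by metis
    with r show "\<exists>s. s \<in> {0..r} \<and> \<mu> (S s \<union> T t) = r" by auto
  qed
  from bchoice[OF this] obtain \<sigma> where \<sigma>: "\<forall>t\<in>{0..r}. \<sigma> t \<in> {0..r} \<and> \<mu> (S (\<sigma> t) \<union> T t) = r" ..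
  define W where "W = (\<lambda>t. S (\<sigma> t) \<union> T t)"
  have W: "W t \<in> closed_connected_sets_of_measure G r" "W t \<in> sets (graph_measure G)" "\<mu> (W t) = r"
    if "0 \<le> t" "t \<le> r" for t
  proof -
    have "\<sigma> t \<in> {0..r}" "\<mu> (W t) = r" using \<sigma> that by (simp_all add: W_def)
    moreover from this have "W t \<in> closed_connected_sets G"
      unfolding W_def using SD(1,2)[of "\<sigma> t"] TD(1,2)[of t] that
      by (intro closed_connected_sets_Un) simp_all
    ultimately show "W t \<in> closed_connected_sets_of_measure G r" "W t \<in> sets (graph_measure G)" "\<mu> (W t) = r"
      using closed_connected_sets_sets by (simp_all add: closed_connected_sets_of_measure_def)
  qed
  have W_diff: "\<mu> (W t - W s) \<le> t - s" if st: "0 \<le> s" "s \<le> t" "t \<le> r" for s t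
  proof (cases "\<sigma> s \<le> \<sigma> t")
    case True
    have "\<sigma> t \<le> r" "0 \<le> \<sigma> s" using \<sigma> st by simp_all
    then have "S (\<sigma> s) \<subseteq> S (\<sigma> t)" using SD(6)[of "\<sigma> t"] True by simp
    moreover have "T s \<subseteq> T t" using TD(6)[of t] st by simp
    ultimately have "W s \<subseteq> W t" by (auto simp: W_def)
    then have "\<mu> (W t - W s) = 0"
      using W[of s] W[of t] st by (simp add: gm.finite_measure_Diff)
    then show ?thesis using st by simp
  next
    case False
    have "\<sigma> s \<le> r" "0 \<le> \<sigma> t" using \<sigma> st by simp_all
    then have "S (\<sigma> t) \<subseteq> S (\<sigma> s)" using SD(6)[of "\<sigma> s"] False by simp
    then have "W t - W s \<subseteq> T t - T s" by (auto simp: W_def)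
    then have "\<mu> (W t - W s) \<le> \<mu> (T t - T s)"
      using TD(5)[of s] TD(5)[of t] st by (intro gm.finite_measure_mono) auto
    also have "\<dots> = t - s"
      using st r by (intro measure_exhaustion_diff[OF T]) simp_all
    finally show ?thesis .
  qed
  have "\<mu> (W 0 - U) \<le> \<mu> (T 0)"
    using SD(3)[of "\<sigma> 0"] \<sigma> \<open>0 \<le> r\<close> TD(5)[of 0] by (intro gm.finite_measure_mono) (auto simp: W_def)
  then have "\<mu> (W 0 - U) = 0"
    using TD(4)[of 0] \<open>0 \<le> r\<close> by (simp add: measure_le_0_iff)
  then have W0: "I (W 0) = I U"
    using abs_integral_diff_le_equal_measure[of "W 0" U] W[of 0] UV_sets r \<open>0 \<le> r\<close> by simp
  have "\<mu> (V - W r) \<le> \<mu> (V - T r)"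
    using UV_sets TD(5)[of r] \<open>0 \<le> r\<close> by (intro gm.finite_measure_mono) (auto simp: W_def)
  also have "\<dots> = 0"
    using UV_sets TD(3-5)[of r] r \<open>0 \<le> r\<close> by (simp add: gm.finite_measure_Diff)
  finally have "\<mu> (V - W r) = 0"
    by (simp add: measure_le_0_iff)
  then have Wr: "I V = I (W r)"
    using abs_integral_diff_le_equal_measure[of V "W r"] W[of r] UV_sets r \<open>0 \<le> r\<close> by simp
  obtain t where t: "t \<in> {0..r}" "- I (W t) = 0"
  proof (rule lipschitz_IVT[of 0 r "\<lambda>t. - I (W t)" 0 "2 * B"])
    fix s t assume st: "0 \<le> s" "s \<le> t" "t \<le> r"
    have "\<bar>- I (W t) - - I (W s)\<bar> = \<bar>I (W t) - I (W s)\<bar>" by simp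
    also have "\<dots> \<le> 2 * B * \<mu> (W t - W s)"
      using W[of s] W[of t] st by (intro abs_integral_diff_le_equal_measure) simp_all
    also have "\<dots> \<le> 2 * B * (t - s)"
      using B_nonneg W_diff[OF st] by (intro mult_left_mono) simp_all
    finally show "\<bar>- I (W t) - - I (W s)\<bar> \<le> 2 * B * (t - s)" .
  qed (use \<open>0 \<le> r\<close> B_nonneg sign W0 Wr in simp_all)
  then show ?thesis
    using W(1)[of t] by (intro that[of "W t"]) simp_all
qed

end

section \<open>Zeros from partitions\<close>

context metric_graph
begin

lemma finite_null_sets:
  assumes "finite N" "N \<subseteq> graph_points G"
  shows "N \<in> null_sets (graph_measure G)"
proof -
  have "{x} \<in> null_sets (graph_measure G)" if "x \<in> N" for x
  proof -
    have x: "x \<in> graph_points G" using assms(2) that by blast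
    then have "{x} \<in> sets (graph_measure G)"
      by (intro closed_connected_sets_sets grown_closed_connected[of x] grown.point)
    with measure_point[OF x] show ?thesis
      by (intro null_setsI) (simp_all add: gm.emeasure_eq_measure)
  qed
  then have "(\<Union>x\<in>N. {x}) \<in> null_sets (graph_measure G)"
    using assms(1) by (intro null_sets_UN' countable_finite)
  then show ?thesis by simp
qed

text \<open>
  The indicator functions of the sets add up to the constant \<open>n\<close> outside a finite set.
\<close>

lemma sum_integral_cover:
  fixes g :: "('v, 'e) gpoint \<Rightarrow> real"
  assumes U: "\<And>\<alpha>. \<alpha> \<in> A \<Longrightarrow> U \<alpha> \<in> sets (graph_measure G)" and "finite A"
    and fin: "finite {x \<in> graph_points G. card {\<alpha> \<in> A. x \<in> U \<alpha>} \<noteq> n}"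
    and g: "integrable (graph_measure G) g"
  shows "(\<Sum>\<alpha>\<in>A. LINT x:U \<alpha>|graph_measure G. g x) = real n * (LINT x:graph_points G|graph_measure G. g x)"
proof -
  have "(\<Sum>\<alpha>\<in>A. LINT x:U \<alpha>|graph_measure G. g x) =
      (LINT x|graph_measure G. (\<Sum>\<alpha>\<in>A. indicator (U \<alpha>) x *\<^sub>R g x))"
    unfolding set_lebesgue_integral_def using U g
    by (intro Bochner_Integration.integral_sum[symmetric] integrable_mult_indicator) simp_all
  also have "\<dots> = (LINT x|graph_measure G. real n * g x)"
  proof (rule integral_cong_AE)
    show "(\<lambda>x. \<Sum>\<alpha>\<in>A. indicator (U \<alpha>) x *\<^sub>R g x) \<in> borel_measurable (graph_measure G)"
      using U g by (intro borel_measurable_sum borel_measurable_scaleR borel_measurable_indicator) auto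
    show "(\<lambda>x. real n * g x) \<in> borel_measurable (graph_measure G)"
      using g by auto
    show "AE x in graph_measure G. (\<Sum>\<alpha>\<in>A. indicator (U \<alpha>) x *\<^sub>R g x) = real n * g x"
    proof (rule AE_I'[OF finite_null_sets[OF fin]], blast, rule subsetI)
      fix x assume x: "x \<in> {x \<in> space (graph_measure G). \<not> (\<Sum>\<alpha>\<in>A. indicator (U \<alpha>) x *\<^sub>R g x) = real n * g x}"
      have "(\<Sum>\<alpha>\<in>A. indicator (U \<alpha>) x *\<^sub>R g x) = (\<Sum>\<alpha>\<in>{\<alpha> \<in> A. x \<in> U \<alpha>}. g x)"
        using \<open>finite A\<close> by (simp add: sum.inter_filter indicator_def if_distrib Int_def cong: if_cong)
      also have "\<dots> = real (card {\<alpha> \<in> A. x \<in> U \<alpha>}) * g x"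
        by simp
      finally show "x \<in> {x \<in> graph_points G. card {\<alpha> \<in> A. x \<in> U \<alpha>} \<noteq> n}"
        using x by (auto simp: space_graph_measure)
    qed
  qed
  also have "\<dots> = real n * (LINT x:graph_points G|graph_measure G. g x)"
    using set_integral_space[OF g] by (simp add: space_graph_measure)
  finally show ?thesis .
qed

lemma edge_segment_closed_connected:
  assumes "e \<in> arcs G" "0 \<le> a" "a \<le> b" "b \<le> 1"
  shows "edge_segment G e a b \<in> closed_connected_sets G"
  using closedin_edge_segment[OF assms(1,2,4)] connectedin_edge_segment[OF assms(1,2,4)] assms(3)
  by (simp add: closed_connected_sets_def edge_segment_def)

end

context bounded_graph_function
begin

text \<open>
  Say that a point is positive if it lies in a set of measure \<open>r\<close> with positive integral.  By
  \<open>zero_between\<close> and the absence of zeros, all sets of measure \<open>r\<close> through a point have the same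
  sign, so this does not depend on the set.  Two points of an edge at distance at most \<open>r\<close> span a segment that extends to a set
  of measure \<open>r\<close>; hence positivity is locally constant along edges, thus constant along
  edges, and by induction over the growth of the graph from a point constant everywhere.
\<close>

lemma same_sign:
  assumes r: "0 < r" "r \<le> \<mu> (graph_points G)"
    and nz: "\<And>W. W \<in> closed_connected_sets_of_measure G r \<Longrightarrow> I W \<noteq> 0"
    and U: "U \<in> closed_connected_sets_of_measure G r" and V: "V \<in> closed_connected_sets_of_measure G r"
  shows "0 < I U \<longleftrightarrow> 0 < I V"
proof -
  define P where "P x \<longleftrightarrow> (\<exists>W\<in>closed_connected_sets_of_measure G r. x \<in> W \<and> 0 < I W)" for x
  have impl: "0 < I W'"
    if WW': "W \<in> closed_connected_sets_of_measure G r" "W' \<in> closed_connected_sets_of_measure G r"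
      "x \<in> W" "x \<in> W'" "0 < I W" for W W' x
  proof (rule ccontr)
    assume "\<not> 0 < I W'"
    then have *: "0 \<le> I W" "I W' \<le> 0" using WW'(5) by simp_all
    obtain Z where "Z \<in> closed_connected_sets_of_measure G r" "I Z = 0"
      by (rule zero_between[OF WW'(1-4) *])
    with nz show False by blast
  qed
  have P_iff: "P x \<longleftrightarrow> 0 < I W" if "W \<in> closed_connected_sets_of_measure G r" "x \<in> W" for W x
    unfolding P_def using impl that by blast
  have near: "P (edge_point G e s) \<longleftrightarrow> P (edge_point G e t)"
    if e: "e \<in> arcs G" and st: "s \<in> {0..1}" "t \<in> {0..1}" "\<bar>s - t\<bar> \<le> r" for e s t
  proof -
    let ?S = "edge_segment G e (min s t) (max s t)"
    have S: "?S \<in> closed_connected_sets G"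
      using e st by (intro edge_segment_closed_connected) auto
    have "\<mu> ?S = max s t - min s t"
      using e st by (intro measure_edge_segment) auto
    with st(3) have "\<mu> ?S \<le> r" by (simp add: max_def min_def split: if_splits)
    obtain W where W: "W \<in> closed_connected_sets_of_measure G r" "?S \<subseteq> W"
      by (rule extend_closed_connected[OF S \<open>\<mu> ?S \<le> r\<close> r(2)])
    have "edge_point G e s \<in> ?S" "edge_point G e t \<in> ?S"
      by (simp_all add: edge_segment_def)
    with W P_iff[OF W(1)] show ?thesis by blast
  qed
  have edge: "P (edge_point G e s) = P (edge_point G e t)"
    if e: "e \<in> arcs G" and st: "s \<in> {0..1}" "t \<in> {0..1}" for e s t
  proof (rule connected_equivalence_relation[of "{0..1::real}" s t])
    fix u :: real assume u: "u \<in> {0..1}"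
    have "openin (top_of_set {0..1}) ({0..1} \<inter> ball u r)"
      by (intro openin_open_Int) simp
    moreover have "u \<in> {0..1} \<inter> ball u r" using u r(1) by simp
    moreover have "\<forall>x\<in>{0..1} \<inter> ball u r. P (edge_point G e u) = P (edge_point G e x)"
      using u near[OF e] by (simp add: dist_real_def)
    ultimately show "\<exists>T. openin (top_of_set {0..1}) T \<and> u \<in> T \<and>
        (\<forall>x\<in>T. P (edge_point G e u) = P (edge_point G e x))"
      by (intro exI conjI)
  qed (use st in simp_all)
  have grown: "P x = P p" if "grown G p K" "x \<in> K" for p x K
    using that
  proof (induction arbitrary: x rule: grown.induct)
    case point
    then show ?case by simp
  next
    case (attach K e a b c)
    show ?case
    proof (cases "x \<in> K")
      case True
      then show ?thesis by (rule attach.IH)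
    next
      case False
      with attach.prems obtain t where t: "t \<in> {a..b}" "x = edge_point G e t"
        unfolding edge_segment_def by blast
      have "P (edge_point G e t) = P (edge_point G e c)"
        using attach.hyps t(1) by (intro edge) auto
      also have "\<dots> = P p" using attach.hyps(6) by (rule attach.IH)
      finally show ?thesis unfolding t(2) .
    qed
  qed
  from U V have ccs: "U \<in> closed_connected_sets G" "V \<in> closed_connected_sets G"
    by (simp_all add: closed_connected_sets_of_measure_def)
  then obtain p q where pq: "p \<in> U" "q \<in> V"
    by (auto simp: closed_connected_sets_def)
  with ccs[THEN closed_connected_sets_subset] have "p \<in> graph_points G" "q \<in> graph_points G"
    by blast+
  then have "P q = P p"
    by (intro grown[OF grown_graph_points])
  with pq P_iff U V show ?thesis by simp
qed

text \<open>
  Applying \<open>sum_integral_cover\<close> to the constant function 1 shows that \<open>r\<close> is positive and that the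
  partition has at least one member.  Applying it to \<open>f\<close>, the integrals over the members
  add up to 0, which is impossible if they are all positive or all negative.
\<close>

lemma zero_of_partition:
  assumes r: "r \<in> partition_set G" and f0: "I (graph_points G) = 0"
  shows "\<exists>W\<in>closed_connected_sets_of_measure G r. I W = 0"
proof (rule ccontr)
  assume no: "\<not> ?thesis"
  then have nz: "I W \<noteq> 0" if "W \<in> closed_connected_sets_of_measure G r" for W
    using that by blast
  obtain n k and U :: "nat \<Rightarrow> ('v, 'e) gpoint set" where n: "n > 0" and U: "\<forall>\<alpha>\<in>{1..k}. U \<alpha> \<in> closed_connected_sets_of_measure G r"
    and fin: "finite {x \<in> graph_points G. card {\<alpha> \<in> {1..k}. x \<in> U \<alpha>} \<noteq> n}"
    using r unfolding partition_set_def by blast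
  have U_sets: "U \<alpha> \<in> sets (graph_measure G)" "\<mu> (U \<alpha>) = r" if "\<alpha> \<in> {1..k}" for \<alpha>
    using U that closed_connected_sets_sets by (simp_all add: closed_connected_sets_of_measure_def)
  have sum: "(\<Sum>\<alpha>\<in>{1..k}. LINT x:U \<alpha>|graph_measure G. g x) = real n * (LINT x:graph_points G|graph_measure G. g x)"
    if "integrable (graph_measure G) g" for g :: "('v, 'e) gpoint \<Rightarrow> real"
    using U_sets(1) fin that by (intro sum_integral_cover) simp_all
  have const: "(LINT x:A|graph_measure G. 1) = \<mu> A" if "A \<in> sets (graph_measure G)" for A
    using that by (simp add: set_lebesgue_integral_def)
  have G_sets: "graph_points G \<in> sets (graph_measure G)"
    by (rule closed_connected_sets_sets[OF graph_points_closed_connected])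
  have "real k * r = (\<Sum>\<alpha>\<in>{1..k}. LINT x:U \<alpha>|graph_measure G. 1)"
    using const U_sets by simp
  also have "\<dots> = real n * \<mu> (graph_points G)"
    using sum[of "\<lambda>_. 1"] const[OF G_sets] by simp
  also have "\<mu> (graph_points G) = real (card (arcs G))"
    by (rule measure_graph_points[OF wf_digraph_axioms finite_arcs])
  finally have "real k * r = real n * real (card (arcs G))" .
  moreover have "0 < real n * real (card (arcs G))"
    using n arcs_nonempty by (simp add: card_gt_0_iff)
  ultimately have "0 < real k * r" by simp
  then have k: "0 < r" "k > 0"
    by (auto simp: zero_less_mult_iff)
  then have 1: "1 \<in> {1..k}" by simp
  have "\<mu> (U 1) \<le> \<mu> (graph_points G)"
    using U 1 closed_connected_sets_subset G_sets
    by (intro gm.finite_measure_mono) (simp_all add: closed_connected_sets_of_measure_def)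
  then have "r \<le> \<mu> (graph_points G)" using U_sets(2)[OF 1] by simp
  note same = same_sign[OF k(1) this nz]
  have sum0: "(\<Sum>\<alpha>\<in>{1..k}. I (U \<alpha>)) = 0"
    using sum[OF integrable_f] f0 by simp
  show False
  proof (cases "0 < I (U 1)")
    case True
    then have "0 < I (U \<alpha>)" if "\<alpha> \<in> {1..k}" for \<alpha>
      using same[of "U 1" "U \<alpha>"] U 1 that by blast
    then have "0 < (\<Sum>\<alpha>\<in>{1..k}. I (U \<alpha>))"
      using k(2) by (intro sum_pos) simp_all
    with sum0 show False by simp
  next
    case False
    then have "I (U \<alpha>) < 0" if "\<alpha> \<in> {1..k}" for \<alpha>
      using same[of "U 1" "U \<alpha>"] nz[of "U \<alpha>"] U 1 that by (meson linorder_less_linear)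
    then have "0 < (\<Sum>\<alpha>\<in>{1..k}. - I (U \<alpha>))"
      using k(2) by (intro sum_pos) simp_all
    with sum0 show False by (simp add: sum_negf)
  qed
qed

end

section \<open>Compactness of the closed connected sets\<close>

lemma common_convergent_subsequence:
  fixes x :: "'k \<Rightarrow> nat \<Rightarrow> real"
  assumes "finite J" "\<forall>j\<in>J. \<forall>i. x j i \<in> {0..1}"
  shows "\<exists>\<phi> l. strict_mono (\<phi> :: nat \<Rightarrow> nat) \<and> (\<forall>j\<in>J. (\<lambda>i. x j (\<phi> i)) \<longlonglongrightarrow> l j)"
  using assms
proof (induction J)
  case empty
  show ?case by (intro exI[of _ id]) (simp add: strict_mono_def)
next
  case (insert k J)
  then obtain \<phi> l where \<phi>: "strict_mono (\<phi> :: nat \<Rightarrow> nat)" "\<forall>j\<in>J. (\<lambda>i. x j (\<phi> i)) \<longlonglongrightarrow> l j"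
    by auto
  have "\<forall>i. x k (\<phi> i) \<in> {0..1}" using insert.prems by simp
  then obtain c \<psi> where \<psi>: "strict_mono (\<psi> :: nat \<Rightarrow> nat)" "((\<lambda>i. x k (\<phi> i)) \<circ> \<psi>) \<longlonglongrightarrow> c"
    by (rule seq_compactE[OF compact_imp_seq_compact[OF compact_Icc]])
  have "(\<lambda>i. x j ((\<phi> \<circ> \<psi>) i)) \<longlonglongrightarrow> (l(k := c)) j" if "j \<in> insert k J" for j
  proof (cases "j = k")
    case True
    with \<psi>(2) show ?thesis by (simp add: o_def)
  next
    case False
    with that \<phi>(2) have "(\<lambda>i. x j (\<phi> i)) \<longlonglongrightarrow> l j" by simp
    from LIMSEQ_subseq_LIMSEQ[OF this \<psi>(1)] False show ?thesis by (simp add: o_def)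
  qed
  moreover have "strict_mono (\<phi> \<circ> \<psi>)" by (rule strict_mono_o[OF \<phi>(1) \<psi>(1)])
  ultimately show ?case by (intro exI conjI ballI)
qed

lemma constant_on_subsequence:
  fixes f :: "nat \<Rightarrow> 'a"
  assumes "finite (range f)"
  obtains c and \<phi> :: "nat \<Rightarrow> nat" where "strict_mono \<phi>" "\<forall>i. f (\<phi> i) = c"
proof -
  obtain i0 where "infinite {i \<in> UNIV. f i = f i0}"
    using pigeonhole_infinite[OF infinite_UNIV_nat assms] by blast
  then obtain \<phi> :: "nat \<Rightarrow> nat" where "strict_mono \<phi>" "\<forall>n. \<phi> n \<in> {i \<in> UNIV. f i = f i0}"
    using infinite_enumerate by blast
  then show ?thesis by (intro that[of \<phi> "f i0"]) simp_all
qed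

text \<open>
  Apart from the diagonal in the case of a single edge, coincidences only occur between
  endpoints, and there are at most four of these.
\<close>

lemma closed_edge_coincidences:
  "closed {z \<in> {0..1} \<times> {0..1}. edge_point G e (fst z) = edge_point G e' (snd z)}" (is "closed ?E")
proof -
  define D where "D = (if e = e' then {z \<in> {0..1} \<times> {0..1::real}. fst z = snd z} else {})"
  have "closed {z \<in> {0..1} \<times> {0..1::real}. fst z = snd z}"
  proof -
    have "closed ({0..1} \<times> {0..1::real} \<inter> {z. fst z = snd z})"
      by (intro closed_Int closed_Times closed_Collect_eq continuous_intros closed_atLeastAtMost)
    then show ?thesis by (simp add: Int_def)
  qed
  then have "closed D" by (simp add: D_def)
  moreover have "finite (?E \<inter> {0, 1} \<times> {0, 1})" by simp
  then have "closed (?E \<inter> {0, 1} \<times> {0, 1})" by (rule finite_imp_closed)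
  ultimately have "closed (D \<union> ?E \<inter> {0, 1} \<times> {0, 1})" by (rule closed_Un)
  moreover have "?E = D \<union> ?E \<inter> {0, 1} \<times> {0, 1}"
  proof
    show "D \<union> ?E \<inter> {0, 1} \<times> {0, 1} \<subseteq> ?E" by (auto simp: D_def split: if_splits)
    show "?E \<subseteq> D \<union> ?E \<inter> {0, 1} \<times> {0, 1}"
    proof
      fix z assume z: "z \<in> ?E"
      then have "edge_point G e (fst z) = edge_point G e' (snd z)" by simp
      from edge_point_eqD[OF this] z show "z \<in> D \<union> ?E \<inter> {0, 1} \<times> {0, 1}"
        by (cases z) (auto simp: D_def)
    qed
  qed
  ultimately show ?thesis by (rule back_subst[where P = closed, OF _ sym])
qed

text \<open>
  The parameters of common points form a sequence in a compact set; any limit of a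
  subsequence is a pair of parameters of a common point of the limit segments.
\<close>

lemma segments_meet_limit:
  assumes lim: "a \<longlonglongrightarrow> l" "b \<longlonglongrightarrow> m" "a' \<longlonglongrightarrow> l'" "b' \<longlonglongrightarrow> m'"
    and bd: "\<And>i. 0 \<le> a i" "\<And>i. b i \<le> 1" "\<And>i. 0 \<le> a' i" "\<And>i. b' i \<le> 1"
    and meet: "\<And>i. edge_segment G e (a i) (b i) \<inter> edge_segment G e' (a' i) (b' i) \<noteq> {}"
  shows "edge_segment G e l m \<inter> edge_segment G e' l' m' \<noteq> {}"
proof -
  let ?E = "{z \<in> {0..1} \<times> {0..1}. edge_point G e (fst z) = edge_point G e' (snd z)}"
  have "\<forall>i. \<exists>z. z \<in> ?E \<and> fst z \<in> {a i..b i} \<and> snd z \<in> {a' i..b' i}"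
  proof
    fix i
    obtain x where "x \<in> edge_segment G e (a i) (b i)" "x \<in> edge_segment G e' (a' i) (b' i)"
      using meet[of i] by blast
    then obtain s t where "s \<in> {a i..b i}" "t \<in> {a' i..b' i}" "edge_point G e s = edge_point G e' t"
      unfolding edge_segment_def by (elim imageE) simp
    with bd[of i] show "\<exists>z. z \<in> ?E \<and> fst z \<in> {a i..b i} \<and> snd z \<in> {a' i..b' i}"
      by (intro exI[of _ "(s, t)"]) simp
  qed
  from choice[OF this] obtain z
    where z: "\<forall>i. z i \<in> ?E \<and> fst (z i) \<in> {a i..b i} \<and> snd (z i) \<in> {a' i..b' i}" ..
  have "compact (({0..1} \<times> {0..1}) \<inter> ?E)"
    by (intro compact_Int_closed compact_Times compact_Icc closed_edge_coincidences)
  moreover have "({0..1} \<times> {0..1}) \<inter> ?E = ?E" by blast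
  ultimately have "seq_compact ?E" by (simp add: compact_imp_seq_compact)
  moreover have "\<forall>i. z i \<in> ?E" using z by blast
  ultimately obtain y r where y: "y \<in> ?E" "strict_mono (r :: nat \<Rightarrow> nat)" "(z \<circ> r) \<longlonglongrightarrow> y"
    by (rule seq_compactE)
  note sub = lim[THEN LIMSEQ_subseq_LIMSEQ, OF y(2)]
  have 1: "(\<lambda>i. fst (z (r i))) \<longlonglongrightarrow> fst y" and 2: "(\<lambda>i. snd (z (r i))) \<longlonglongrightarrow> snd y"
    using tendsto_fst[OF y(3)] tendsto_snd[OF y(3)] by (simp_all add: o_def)
  have "l \<le> fst y" by (rule LIMSEQ_le[OF sub(1) 1]) (use z in simp)
  moreover have "fst y \<le> m" by (rule LIMSEQ_le[OF 1 sub(2)]) (use z in simp)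
  moreover have "l' \<le> snd y" by (rule LIMSEQ_le[OF sub(3) 2]) (use z in simp)
  moreover have "snd y \<le> m'" by (rule LIMSEQ_le[OF 2 sub(4)]) (use z in simp)
  ultimately have "edge_point G e (fst y) \<in> edge_segment G e l m"
    "edge_point G e' (snd y) \<in> edge_segment G e' l' m'"
    by (simp_all add: edge_segment_def)
  moreover have "edge_point G e (fst y) = edge_point G e' (snd y)" using y(1) by simp
  ultimately show ?thesis by auto
qed

context metric_graph
begin

text \<open>
  Linkedness passes to the limit: for a splitting of \<open>J\<close>, each set of the sequence has two
  segments that bridge it, and since \<open>J\<close> is finite some pair does so infinitely often.
\<close>

lemma closed_connected_limit:
  fixes a b :: "nat \<Rightarrow> 'k \<Rightarrow> real"
  assumes J: "finite J" "\<And>j. j \<in> J \<Longrightarrow> e j \<in> arcs G"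
    and ab: "\<And>i j. j \<in> J \<Longrightarrow> 0 \<le> a i j \<and> a i j \<le> b i j \<and> b i j \<le> 1"
    and cc: "\<And>i. (\<Union>j\<in>J. edge_segment G (e j) (a i j) (b i j)) \<in> closed_connected_sets G"
    and lim: "\<And>j. j \<in> J \<Longrightarrow> (\<lambda>i. a i j) \<longlonglongrightarrow> l j" "\<And>j. j \<in> J \<Longrightarrow> (\<lambda>i. b i j) \<longlonglongrightarrow> m j"
  shows "(\<Union>j\<in>J. edge_segment G (e j) (l j) (m j)) \<in> closed_connected_sets G" (is "?V \<in> _")
proof -
  have lm: "0 \<le> l j \<and> l j \<le> m j \<and> m j \<le> 1" if "j \<in> J" for j
  proof (intro conjI)
    show "0 \<le> l j" by (rule LIMSEQ_le_const[OF lim(1)[OF that]]) (use ab[OF that] in simp)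
    show "m j \<le> 1" by (rule LIMSEQ_le_const2[OF lim(2)[OF that]]) (use ab[OF that] in simp)
    show "l j \<le> m j" by (rule LIMSEQ_le[OF lim(1,2)[OF that]]) (use ab[OF that] in simp)
  qed
  have "linked J (\<lambda>j. edge_segment G (e j) (l j) (m j))"
    unfolding linked_def
  proof (intro allI impI, elim conjE)
    fix R assume R: "R \<subseteq> J" "R \<noteq> {}" "R \<noteq> J"
    have "\<forall>i. \<exists>q. q \<in> R \<times> (J - R) \<and> edge_segment G (e (fst q)) (a i (fst q)) (b i (fst q)) \<inter>
        edge_segment G (e (snd q)) (a i (snd q)) (b i (snd q)) \<noteq> {}"
    proof
      fix i
      have "linked J (\<lambda>j. edge_segment G (e j) (a i j) (b i j))"
        using cc J ab by (intro closed_connected_imp_linked) simp_all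
      with R obtain j k where "j \<in> R" "k \<in> J - R"
        "edge_segment G (e j) (a i j) (b i j) \<inter> edge_segment G (e k) (a i k) (b i k) \<noteq> {}"
        unfolding linked_def by blast
      then show "\<exists>q. q \<in> R \<times> (J - R) \<and> edge_segment G (e (fst q)) (a i (fst q)) (b i (fst q)) \<inter>
          edge_segment G (e (snd q)) (a i (snd q)) (b i (snd q)) \<noteq> {}"
        by (intro exI[of _ "(j, k)"]) simp
    qed
    from choice[OF this] obtain q where q: "\<forall>i. q i \<in> R \<times> (J - R) \<and>
        edge_segment G (e (fst (q i))) (a i (fst (q i))) (b i (fst (q i))) \<inter>
        edge_segment G (e (snd (q i))) (a i (snd (q i))) (b i (snd (q i))) \<noteq> {}" ..
    have "finite R" using R(1) J(1) by (rule finite_subset)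
    then have "finite (R \<times> (J - R))" using J(1) by simp
    moreover have "range q \<subseteq> R \<times> (J - R)" using q by blast
    ultimately have "finite (range q)" by (rule finite_subset[rotated])
    then obtain c and \<phi> :: "nat \<Rightarrow> nat" where \<phi>: "strict_mono \<phi>" "\<forall>i. q (\<phi> i) = c"
      by (rule constant_on_subsequence)
    define j k where "j = fst c" and "k = snd c"
    have jk: "j \<in> R" "k \<in> J - R" and meet: "\<And>i. edge_segment G (e j) (a (\<phi> i) j) (b (\<phi> i) j) \<inter>
        edge_segment G (e k) (a (\<phi> i) k) (b (\<phi> i) k) \<noteq> {}"
      using q \<phi>(2) unfolding j_def k_def by (metis mem_Times_iff)+
    then have "j \<in> J" "k \<in> J" using R(1) by auto
    have "edge_segment G (e j) (l j) (m j) \<inter> edge_segment G (e k) (l k) (m k) \<noteq> {}"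
    proof (rule segments_meet_limit)
      show "(\<lambda>i. a (\<phi> i) j) \<longlonglongrightarrow> l j" "(\<lambda>i. b (\<phi> i) j) \<longlonglongrightarrow> m j"
        "(\<lambda>i. a (\<phi> i) k) \<longlonglongrightarrow> l k" "(\<lambda>i. b (\<phi> i) k) \<longlonglongrightarrow> m k"
        using lim \<open>j \<in> J\<close> \<open>k \<in> J\<close> LIMSEQ_subseq_LIMSEQ[OF _ \<phi>(1)] unfolding o_def by blast+
    qed (use meet ab \<open>j \<in> J\<close> \<open>k \<in> J\<close> in simp_all)
    with jk show "\<exists>j\<in>R. \<exists>k\<in>J - R. edge_segment G (e j) (l j) (m j) \<inter> edge_segment G (e k) (l k) (m k) \<noteq> {}"
      by (intro bexI)
  qed
  moreover have "J \<noteq> {}"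
    using cc[of 0] by (auto simp: closed_connected_sets_def)
  then obtain j where "j \<in> J" by blast
  with lm[of j] have p: "edge_point G (e j) (l j) \<in> ?V"
    by (intro UN_I[of j]) (simp_all add: edge_segment_def)
  have "l j \<in> {0..1}" using lm[OF \<open>j \<in> J\<close>] by auto
  then have "edge_point G (e j) (l j) \<in> graph_points G"
    by (rule edge_point_in_graph_points[OF wf_digraph_axioms J(2)[OF \<open>j \<in> J\<close>]])
  ultimately have "grown G (edge_point G (e j) (l j)) ?V"
    using J lm p by (intro linked_imp_grown) simp_all
  then show ?thesis by (rule grown_closed_connected)
qed

lemma measure_Union_segments_diff_le:
  assumes "finite J" and J: "\<And>j. j \<in> J \<Longrightarrow> e j \<in> arcs G"
    and "\<And>j. j \<in> J \<Longrightarrow> a j \<in> {0..1} \<and> b j \<in> {0..1} \<and> a' j \<in> {0..1} \<and> b' j \<in> {0..1}"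
  shows "\<mu> ((\<Union>j\<in>J. edge_segment G (e j) (a j) (b j)) - (\<Union>j\<in>J. edge_segment G (e j) (a' j) (b' j)))
    \<le> (\<Sum>j\<in>J. \<bar>a j - a' j\<bar> + \<bar>b j - b' j\<bar>)"
proof -
  let ?S = "\<lambda>j. edge_segment G (e j) (a j) (b j)" and ?S' = "\<lambda>j. edge_segment G (e j) (a' j) (b' j)"
  have sets: "?S j \<in> sets (graph_measure G)" "?S' j \<in> sets (graph_measure G)" if "j \<in> J" for j
    using J[OF that] assms(3)[OF that] by (auto intro!: edge_segment_sets)
  have diff_sets: "?S j - ?S' j \<in> sets (graph_measure G)" if "j \<in> J" for j
    using sets[OF that] by (rule sets.Diff)
  have "\<mu> ((\<Union>j\<in>J. ?S j) - (\<Union>j\<in>J. ?S' j)) \<le> \<mu> (\<Union>j\<in>J. ?S j - ?S' j)"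
    using \<open>finite J\<close> diff_sets by (intro gm.finite_measure_mono sets.finite_UN) auto
  also have "\<dots> \<le> (\<Sum>j\<in>J. \<mu> (?S j - ?S' j))"
    using \<open>finite J\<close> diff_sets by (intro gm.finite_measure_subadditive_finite) auto
  also have "\<dots> \<le> (\<Sum>j\<in>J. \<bar>a j - a' j\<bar> + \<bar>b j - b' j\<bar>)"
    using J assms(3) by (intro sum_mono measure_edge_segment_diff_le) simp_all
  finally show ?thesis .
qed

text \<open>
  Pass to a subsequence along which the finite index set of the segments is constant, and
  then to one along which all their endpoints converge.
\<close>

lemma closed_connected_sequence_compact:
  assumes "\<And>i. W i \<in> closed_connected_sets G"
  obtains V and \<phi> :: "nat \<Rightarrow> nat" where "strict_mono \<phi>" "V \<in> closed_connected_sets G"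
    "(\<lambda>i. \<mu> (W (\<phi> i) - V)) \<longlonglongrightarrow> 0" "(\<lambda>i. \<mu> (V - W (\<phi> i))) \<longlonglongrightarrow> 0"
proof -
  have "\<forall>i. \<exists>J a b. J \<subseteq> arcs G \<times> (UNIV :: bool set) \<and> (\<forall>j\<in>J. 0 \<le> a j \<and> a j \<le> b j \<and> b j \<le> 1) \<and>
      W i = (\<Union>j\<in>J. edge_segment G (fst j) (a j) (b j))"
  proof
    fix i
    obtain J a b where "J \<subseteq> arcs G \<times> (UNIV :: bool set)" "\<forall>j\<in>J. 0 \<le> a j \<and> a j \<le> b j \<and> b j \<le> 1"
      "W i = (\<Union>j\<in>J. edge_segment G (fst j) (a j) (b j))"
      by (rule closed_connected_eq_Union_segments[OF assms])
    then show "\<exists>J a b. J \<subseteq> arcs G \<times> (UNIV :: bool set) \<and>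
        (\<forall>j\<in>J. 0 \<le> a j \<and> a j \<le> b j \<and> b j \<le> 1) \<and>
        W i = (\<Union>j\<in>J. edge_segment G (fst j) (a j) (b j))"
      by (intro exI conjI)
  qed
  from choice[OF this] obtain JJ where "\<forall>i. \<exists>a b. JJ i \<subseteq> arcs G \<times> (UNIV :: bool set) \<and>
      (\<forall>j\<in>JJ i. 0 \<le> a j \<and> a j \<le> b j \<and> b j \<le> 1) \<and>
      W i = (\<Union>j\<in>JJ i. edge_segment G (fst j) (a j) (b j))" ..
  from choice[OF this] obtain a where "\<forall>i. \<exists>b. JJ i \<subseteq> arcs G \<times> (UNIV :: bool set) \<and>
      (\<forall>j\<in>JJ i. 0 \<le> a i j \<and> a i j \<le> b j \<and> b j \<le> 1) \<and>
      W i = (\<Union>j\<in>JJ i. edge_segment G (fst j) (a i j) (b j))" ..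
  from choice[OF this] obtain b where "\<forall>i. JJ i \<subseteq> arcs G \<times> (UNIV :: bool set) \<and>
      (\<forall>j\<in>JJ i. 0 \<le> a i j \<and> a i j \<le> b i j \<and> b i j \<le> 1) \<and>
      W i = (\<Union>j\<in>JJ i. edge_segment G (fst j) (a i j) (b i j))" ..
  note W = this[THEN spec, THEN conjunct1] this[THEN spec, THEN conjunct2, THEN conjunct1]
    this[THEN spec, THEN conjunct2, THEN conjunct2]
  have "range JJ \<subseteq> Pow (arcs G \<times> UNIV)" using W(1) by blast
  then have "finite (range JJ)" by (rule finite_subset) simp
  then obtain J and \<rho> :: "nat \<Rightarrow> nat" where \<rho>: "strict_mono \<rho>" "\<forall>i. JJ (\<rho> i) = J"
    by (rule constant_on_subsequence)
  have J: "J \<subseteq> arcs G \<times> UNIV" using W(1)[of "\<rho> 0"] \<rho>(2) by simp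
  then have "finite J" by (rule finite_subset) simp
  have fst_J: "fst j \<in> arcs G" if "j \<in> J" for j using J that by auto
  have ab: "0 \<le> a (\<rho> i) j \<and> a (\<rho> i) j \<le> b (\<rho> i) j \<and> b (\<rho> i) j \<le> 1" if "j \<in> J" for i j
    using W(2)[of "\<rho> i"] \<rho>(2) that by simp
  \<comment> \<open>Lower and upper endpoints are put into one finite family of bounded sequences.\<close>
  define x where "x = (\<lambda>(j, lower) i. if lower then a (\<rho> i) j else b (\<rho> i) j)"
  have "finite (J \<times> (UNIV :: bool set))" using \<open>finite J\<close> by simp
  moreover have "\<forall>j\<in>J \<times> UNIV. \<forall>i. x j i \<in> {0..1}"
    using ab by (auto simp: x_def intro: order_trans)
  ultimately obtain \<psi> :: "nat \<Rightarrow> nat" and l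
    where \<psi>: "strict_mono \<psi>" "\<forall>j\<in>J \<times> UNIV. (\<lambda>i. x j (\<psi> i)) \<longlonglongrightarrow> l j"
    using common_convergent_subsequence by blast
  define \<phi> where "\<phi> = \<rho> \<circ> \<psi>"
  have lim: "(\<lambda>i. a (\<phi> i) j) \<longlonglongrightarrow> l (j, True)" "(\<lambda>i. b (\<phi> i) j) \<longlonglongrightarrow> l (j, False)" if "j \<in> J" for j
    using \<psi>(2)[THEN bspec, of "(j, True)"] \<psi>(2)[THEN bspec, of "(j, False)"] that
    by (simp_all add: x_def \<phi>_def)
  have ab': "0 \<le> a (\<phi> i) j \<and> a (\<phi> i) j \<le> b (\<phi> i) j \<and> b (\<phi> i) j \<le> 1" if "j \<in> J" for i j
    using ab[OF that] by (simp add: \<phi>_def)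
  have W': "W (\<phi> i) = (\<Union>j\<in>J. edge_segment G (fst j) (a (\<phi> i) j) (b (\<phi> i) j))" for i
    using W(3) \<rho>(2) by (simp add: \<phi>_def)
  define V where "V = (\<Union>j\<in>J. edge_segment G (fst j) (l (j, True)) (l (j, False)))"
  have V: "V \<in> closed_connected_sets G"
    unfolding V_def
  proof (rule closed_connected_limit[OF \<open>finite J\<close>, where e = fst])
    show "(\<Union>j\<in>J. edge_segment G (fst j) (a (\<phi> i) j) (b (\<phi> i) j)) \<in> closed_connected_sets G" for i
      unfolding W'[symmetric] by (rule assms)
  qed (use fst_J ab' lim in simp_all)
  have l01: "l (j, True) \<in> {0..1} \<and> l (j, False) \<in> {0..1}" if "j \<in> J" for j
  proof (intro conjI)
    show "l (j, True) \<in> {0..1}"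
      by (rule closed_sequentially[OF closed_atLeastAtMost _ lim(1)[OF that]])
        (use ab'[OF that] in \<open>auto intro: order_trans\<close>)
    show "l (j, False) \<in> {0..1}"
      by (rule closed_sequentially[OF closed_atLeastAtMost _ lim(2)[OF that]])
        (use ab'[OF that] in \<open>auto intro: order_trans\<close>)
  qed
  let ?d = "\<lambda>i. \<Sum>j\<in>J. \<bar>a (\<phi> i) j - l (j, True)\<bar> + \<bar>b (\<phi> i) j - l (j, False)\<bar>"
  have "?d \<longlonglongrightarrow> (\<Sum>j\<in>J. \<bar>l (j, True) - l (j, True)\<bar> + \<bar>l (j, False) - l (j, False)\<bar>)"
    using lim by (intro tendsto_intros) simp_all
  then have d: "?d \<longlonglongrightarrow> 0" by simp
  have in01: "a (\<phi> i) j \<in> {0..1} \<and> b (\<phi> i) j \<in> {0..1}" if "j \<in> J" for i j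
    using ab'[OF that, of i] by simp
  have 1: "\<mu> (W (\<phi> i) - V) \<le> ?d i" for i
    unfolding W' V_def using fst_J in01 l01 \<open>finite J\<close>
    by (intro measure_Union_segments_diff_le) simp_all
  have "\<mu> (V - W (\<phi> i)) \<le> (\<Sum>j\<in>J. \<bar>l (j, True) - a (\<phi> i) j\<bar> + \<bar>l (j, False) - b (\<phi> i) j\<bar>)" for i
    unfolding W' V_def using fst_J in01 l01 \<open>finite J\<close>
    by (intro measure_Union_segments_diff_le) simp_all
  then have 2: "\<mu> (V - W (\<phi> i)) \<le> ?d i" for i
    by (simp add: abs_minus_commute)
  show ?thesis
  proof (rule that)
    show "strict_mono \<phi>" unfolding \<phi>_def by (rule strict_mono_o[OF \<rho>(1) \<psi>(1)])
    show "V \<in> closed_connected_sets G" by (rule V)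
    show "(\<lambda>i. \<mu> (W (\<phi> i) - V)) \<longlonglongrightarrow> 0"
      by (rule tendsto_sandwich[OF _ _ tendsto_const d]) (simp_all add: 1)
    show "(\<lambda>i. \<mu> (V - W (\<phi> i))) \<longlonglongrightarrow> 0"
      by (rule tendsto_sandwich[OF _ _ tendsto_const d]) (simp_all add: 2)
  qed
qed

end

section \<open>The closure of the partition set\<close>

context bounded_graph_function
begin

text \<open>
  Measure and integral are continuous under the convergence of
  \<open>closed_connected_sequence_compact\<close>, so the limit of sets with integral 0 is as required.
\<close>

lemma zero_of_closure:
  assumes r: "r \<in> closure R"
    and zero: "\<And>s. s \<in> R \<Longrightarrow> \<exists>W\<in>closed_connected_sets_of_measure G s. I W = 0"
  shows "\<exists>W\<in>closed_connected_sets_of_measure G r. I W = 0"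
proof -
  obtain s where s: "\<forall>i. s i \<in> R" "s \<longlonglongrightarrow> r"
    using r unfolding closure_sequential by blast
  have "\<forall>i. \<exists>W. W \<in> closed_connected_sets_of_measure G (s i) \<and> I W = 0"
    using s(1) zero by blast
  from choice[OF this] obtain W where W: "\<forall>i. W i \<in> closed_connected_sets_of_measure G (s i) \<and> I (W i) = 0" ..
  then have W_cc: "W i \<in> closed_connected_sets G" and W_measure: "\<mu> (W i) = s i" for i
    by (simp_all add: closed_connected_sets_of_measure_def)
  obtain V and \<phi> :: "nat \<Rightarrow> nat" where \<phi>: "strict_mono \<phi>" and V: "V \<in> closed_connected_sets G"
    and lim: "(\<lambda>i. \<mu> (W (\<phi> i) - V)) \<longlonglongrightarrow> 0" "(\<lambda>i. \<mu> (V - W (\<phi> i))) \<longlonglongrightarrow> 0"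
    by (rule closed_connected_sequence_compact[OF W_cc])
  note sets = W_cc[THEN closed_connected_sets_sets] V[THEN closed_connected_sets_sets]
  let ?d = "\<lambda>i. \<mu> (W (\<phi> i) - V) + \<mu> (V - W (\<phi> i))"
  have d: "?d \<longlonglongrightarrow> 0" using tendsto_add[OF lim] by simp
  have "(\<lambda>i. s (\<phi> i)) \<longlonglongrightarrow> \<mu> V"
  proof (rule LIM_zero_cancel, rule tendsto_rabs_zero_cancel)
    have "\<bar>s (\<phi> i) - \<mu> V\<bar> \<le> ?d i" for i
    proof -
      have "\<mu> (W (\<phi> i)) \<le> \<mu> V + \<mu> (W (\<phi> i) - V)" "\<mu> V \<le> \<mu> (W (\<phi> i)) + \<mu> (V - W (\<phi> i))"
        by (intro measure_le_measure_plus_diff sets)+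
      moreover have "0 \<le> \<mu> (W (\<phi> i) - V)" "0 \<le> \<mu> (V - W (\<phi> i))"
        by (rule measure_nonneg)+
      ultimately show ?thesis
        unfolding W_measure by linarith
    qed
    then show "(\<lambda>i. \<bar>s (\<phi> i) - \<mu> V\<bar>) \<longlonglongrightarrow> 0"
      by (intro tendsto_sandwich[OF _ _ tendsto_const d]) simp_all
  qed
  moreover have "(\<lambda>i. s (\<phi> i)) \<longlonglongrightarrow> r"
    using LIMSEQ_subseq_LIMSEQ[OF s(2) \<phi>] by (simp add: o_def)
  ultimately have "\<mu> V = r" by (rule LIMSEQ_unique)
  moreover have "I V = 0"
  proof -
    have "\<bar>I V\<bar> \<le> B * ?d i" for i
      using abs_integral_diff_le[of V "W (\<phi> i)"] sets W by (simp add: add.commute)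
    then have "\<bar>I V\<bar> \<le> B * 0"
      by (intro LIMSEQ_le_const[OF tendsto_mult_left[OF d]]) simp
    then show ?thesis by simp
  qed
  ultimately show ?thesis
    using V by (intro bexI[of _ V]) (simp_all add: closed_connected_sets_of_measure_def)
qed

end

theorem theorem5:
  fixes G :: "('v, 'e) pre_digraph"
  assumes "fin_digraph G"
    and "Digraph_Component.connected G"
    and "arcs G \<noteq> {}"
  shows "closure (partition_set G) \<subseteq> chord_set G"
proof
  fix r assume r: "r \<in> closure (partition_set G)"
  interpret fin_digraph G by (rule assms(1))
  interpret metric_graph G by unfold_locales (rule assms(2,3))+
  show "r \<in> chord_set G"
    unfolding chord_set_def
  proof (rule CollectI, intro ballI impI)
    fix f assume f: "f \<in> L1_graph G" "(LINT x:graph_points G|graph_measure G. f x) = 0"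
    obtain B where B: "\<forall>x\<in>graph_points G. \<bar>f x\<bar> \<le> B"
      using f(1) by (rule L1_graph_bounded)
    interpret bounded_graph_function G f B
      using B L1_graph_measurable[OF f(1)] by unfold_locales simp_all
    show "\<exists>U\<in>closed_connected_sets_of_measure G r. (LINT x:U|graph_measure G. f x) = 0"
      by (rule zero_of_closure[OF r]) (rule zero_of_partition[OF _ f(2)])
  qed
qed

end
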